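(* There is a constant $C>0$ such that the following holds. Let $f\in W^{1,1}(\mathbb R)$ be such that $\widehat f(0)=0$, and let $\mu>0$. Then for all $t>0$ and $X\in\mathbb R$, $$\left|\int_{\mathbb R}e^{-it\xi\omega(\sqrt\mu\,\xi)}e^{iX\xi}\widehat f(\xi)\,d\xi\right|\le\frac C{\sqrt t}\left(\frac1{\sqrt\mu}\left|\frac1{\sqrt{|\xi|}}\,(\widehat f)'\right|_{L^1(\mathbb R)}+\mu^{\frac18}\left||\xi|^{\frac34}\,(\widehat f)'\right|_{L^1(\mathbb R)}\right).$$
   Context: $\omega(\xi)=\sqrt{\frac{\tanh\xi}{\xi}}$ (with $\omega(0)=1$). $\widehat f$ is the Fourier transform of $f$ on $\mathbb R$ and $(\widehat f)'$ its derivative in $\xi$. The inequality is meaningful when the right-hand side is finite; the integral on the left is understood as $\lim_{M\to+\infty}\int_{-M}^{M}$. *)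

theory Defs
  imports "HOL-Analysis.Analysis"
begin

definition omega :: "real \<Rightarrow> real" where
  "omega \<xi> = (if \<xi> = 0 then 1 else sqrt (tanh \<xi> / \<xi>))"

(* Angular-frequency convention, without a normalising factor. A factor in front of the integral
   would scale both sides of the dispersive estimate by the same amount. *)
definition fourier :: "(real \<Rightarrow> complex) \<Rightarrow> real \<Rightarrow> complex" where
  "fourier f \<xi> = (LINT x|lebesgue. exp (- (\<i> * of_real (x * \<xi>))) * f x)"

definition test_function :: "(real \<Rightarrow> real) \<Rightarrow> bool" where
  "test_function \<phi> \<longleftrightarrow>
     (\<forall>k x. (deriv ^^ k) \<phi> differentiable (at x)) \<and> compact (closure {x. \<phi> x \<noteq> 0})"

definition locally_integrable :: "(real \<Rightarrow> complex) \<Rightarrow> bool" where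
  "locally_integrable f \<longleftrightarrow> (\<forall>K. compact K \<longrightarrow> f absolutely_integrable_on K)"

(* Real-valued test functions suffice for complex-valued f and g: by linearity the identity extends
   to complex-valued ones. The weak derivative is unique up to null sets, hence a relation. *)
definition has_weak_derivative :: "(real \<Rightarrow> complex) \<Rightarrow> (real \<Rightarrow> complex) \<Rightarrow> bool" where
  "has_weak_derivative f g \<longleftrightarrow> locally_integrable f \<and> locally_integrable g \<and>
     (\<forall>\<phi>. test_function \<phi> \<longrightarrow>
        (LINT x|lebesgue. deriv \<phi> x *\<^sub>R f x) = - (LINT x|lebesgue. \<phi> x *\<^sub>R g x))"

definition W11 :: "(real \<Rightarrow> complex) set" where
  "W11 = {f. integrable lebesgue f \<and> (\<exists>g. has_weak_derivative f g \<and> integrable lebesgue g)}"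

end

theory Submission
  imports Defs
begin

text \<open>
  Write $g$ for the Fourier transform of $f$. Put $\varphi(x) = \sqrt{x \tanh x}$, so that
  $\xi\,\omega(\sqrt\mu\,\xi) = \varphi(\sqrt\mu\,\xi)/\sqrt\mu$ for $\xi \ge 0$. With
  $T = \tanh x$ and $S = 1 - T^2$ one finds
  $-\varphi'' = ((T - xS)^2 + 4x^2T^2S) / (4 (xT)^{3/2})$, which is at least a multiple of $x$ on
  $(0,1]$ and of $x^{-3/2}$ on $[1,\infty)$. Van der Corput's second derivative test then bounds the
  primitive of the oscillating factor that vanishes at $1/\sqrt\mu$ by $C t^{-1/2}$ times the weight
  $\mu^{-1/2} \xi^{-1/2} + \mu^{1/8} \xi^{3/4}$, and one integrates by parts against $g$ on $[0,M]$.
  The boundary term at $0$ vanishes because $g(0) = 0$; the one at $M$ tends to $0$ because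
  $f \in W^{1,1}$ makes $|\xi|\,|g(\xi)|$ bounded while the weight grows like $\xi^{3/4}$. Negative
  frequencies reduce to positive ones by complex conjugation.
\<close>

subsection \<open>Smooth cutoff functions\<close>

text \<open>Two obstacles shape the proof. First, the second derivative of the phase tends to 0 both
  at frequency 0 and at infinity, so van der Corput's test gives nothing on a whole half line.
  Starting the primitive at \<open>1 / sqrt \<mu>\<close>, where the two regimes meet, puts the
  worst lower bound for the second derivative at the other endpoint of the interval, and its value
  there produces exactly the two powers in the weight. Moving the base point away from 0 only adds a
  constant to the primitive, and this constant is what g(0) = 0 absorbs. Second, the derivative of g
  is a weak one, known only through smooth compactly supported test functions. A smooth step
  function, built by hand, turns it into increments of g, and the integration by parts then works
  with these increments and never with pointwise derivatives of g. The same step function cuts off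
  cosines and sines, which are not compactly supported, when the weak derivative of f is used to get
  the decay of g.\<close>

fun times_differentiable :: "nat \<Rightarrow> (real \<Rightarrow> real) \<Rightarrow> bool" where
  "times_differentiable 0 f \<longleftrightarrow> True"
| "times_differentiable (Suc k) f \<longleftrightarrow>
     (\<exists>f'. (\<forall>x. (f has_real_derivative f' x) (at x)) \<and> times_differentiable k f')"

lemma times_differentiable_SucD: "times_differentiable (Suc k) f \<Longrightarrow> times_differentiable k f"
proof (induction k arbitrary: f)
  case (Suc k)
  then obtain f' where "\<And>x. (f has_real_derivative f' x) (at x)" "times_differentiable (Suc k) f'"
    by auto
  then show ?case using Suc.IH[of f'] by auto
qed simp

lemma times_differentiable_add:
  "times_differentiable k f \<Longrightarrow> times_differentiable k g \<Longrightarrow> times_differentiable k (\<lambda>x. f x + g x)"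
proof (induction k arbitrary: f g)
  case (Suc k)
  then obtain f' g' where d: "\<And>x. (f has_real_derivative f' x) (at x)" "times_differentiable k f'"
     "\<And>x. (g has_real_derivative g' x) (at x)" "times_differentiable k g'"
    by auto
  have "((\<lambda>x. f x + g x) has_real_derivative f' x + g' x) (at x)" for x
    by (rule DERIV_add d)+
  with Suc.IH[OF d(2,4)] show ?case by (auto intro!: exI[of _ "\<lambda>x. f' x + g' x"])
qed simp

lemma times_differentiable_mult:
  "times_differentiable k f \<Longrightarrow> times_differentiable k g \<Longrightarrow> times_differentiable k (\<lambda>x. f x * g x)"
proof (induction k arbitrary: f g)
  case (Suc k)
  then obtain f' g' where d: "\<And>x. (f has_real_derivative f' x) (at x)" "times_differentiable k f'"
     "\<And>x. (g has_real_derivative g' x) (at x)" "times_differentiable k g'"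
    by auto
  have "((\<lambda>x. f x * g x) has_real_derivative f' x * g x + g' x * f x) (at x)" for x
    by (rule DERIV_mult d)+
  moreover have "times_differentiable k (\<lambda>x. f' x * g x + g' x * f x)"
    by (intro times_differentiable_add Suc.IH d(2,4) Suc.prems[THEN times_differentiable_SucD])
  ultimately show ?case by (auto intro!: exI[of _ "\<lambda>x. f' x * g x + g' x * f x"])
qed simp

lemma times_differentiable_const: "times_differentiable k (\<lambda>x. c)"
proof (induction k arbitrary: c)
  case (Suc k)
  show ?case using Suc[of 0] by (auto intro!: exI[of _ "\<lambda>x. 0"])
qed simp

lemma times_differentiable_affine:
  "times_differentiable k f \<Longrightarrow> times_differentiable k (\<lambda>x. f (c * x + d))"
proof (induction k arbitrary: f)
  case (Suc k)
  then obtain f' where d: "\<And>x. (f has_real_derivative f' x) (at x)" "times_differentiable k f'"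
    by auto
  have "((\<lambda>x. f (c * x + d)) has_real_derivative f' (c * x + d) * c) (at x)" for x
    by (rule DERIV_chain2[OF d(1)]) (auto intro!: derivative_eq_intros)
  moreover have "times_differentiable k (\<lambda>x. f' (c * x + d) * c)"
    using Suc.IH[OF d(2)] by (intro times_differentiable_mult times_differentiable_const)
  ultimately show ?case by (auto intro!: exI[of _ "\<lambda>x. f' (c * x + d) * c"])
qed simp

text \<open>Both coefficients are kept free because differentiation exchanges cosine and sine; the
  two-parameter family is closed under it, so the induction goes through.\<close>

lemma times_differentiable_cos_sin:
  "times_differentiable k (\<lambda>x. a * cos (w * x) + b * sin (w * x))"
proof (induction k arbitrary: a b)
  case (Suc k)
  show ?case using Suc[of "b * w" "- a * w"]
    by (auto intro!: exI[of _ "\<lambda>x. b * w * cos (w * x) + - a * w * sin (w * x)"] derivative_eq_intros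
        simp: algebra_simps)
qed simp

text \<open>Link to the iterated \<open>deriv\<close> in \<open>test_function\<close>. The recursive
  predicate names each derivative as a witness, which makes sums, products and compositions plain
  inductions; \<open>deriv\<close> enters only here.\<close>

lemma times_differentiable_deriv:
  assumes "times_differentiable (Suc k) f"
  shows "(deriv ^^ k) f differentiable (at x)"
  using assms
proof (induction k arbitrary: f)
  case 0
  then show ?case using real_differentiable_def by auto
next
  case (Suc k)
  then obtain f' where d: "\<And>x. (f has_real_derivative f' x) (at x)" "times_differentiable (Suc k) f'"
    by auto
  then have "deriv f = f'" by (auto intro!: DERIV_imp_deriv)
  then show ?case using Suc.IH[OF d(2)] by (simp add: funpow_Suc_right del: funpow.simps)
qed

lemma test_functionI:
  assumes "\<And>k. times_differentiable k \<phi>" "\<And>x. x \<notin> {a..b} \<Longrightarrow> \<phi> x = 0"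
  shows "test_function \<phi>"
proof -
  have "{x. \<phi> x \<noteq> 0} \<subseteq> {a..b}" using assms(2) by blast
  then have "bounded {x. \<phi> x \<noteq> 0}" by (rule bounded_subset[OF bounded_closed_interval])
  then show ?thesis unfolding test_function_def
    using times_differentiable_deriv[OF assms(1)] by auto
qed

text \<open>The polynomial factor in 1/x strengthens the induction: the functions p(1/x) exp(-1/x),
  extended by 0, are closed under differentiation, while exp(-1/x) alone is not.\<close>

lemma times_differentiable_exp_inverse:
  "times_differentiable k (\<lambda>x::real. if x > 0 then poly p (1/x) * exp (- (1/x)) else 0)"
proof (induction k arbitrary: p)
  case (Suc k)
  let ?F = "\<lambda>p x::real. if x > 0 then poly p (1/x) * exp (- (1/x)) else 0"
  \<comment> \<open>With y = 1/x, the chain rule multiplies by -y^2 and the exponential contributes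
    -1, so p becomes y^2 (p - p').\<close>
  define q where "q = [:0,0,1:] * (p - pderiv p)"
  have lim: "((\<lambda>x. poly p (1/x) * exp (- (1/x))) \<longlongrightarrow> 0) (at_right 0)" for p :: "real poly"
  proof -
    have "((\<lambda>y::real. \<Sum>i\<le>degree p. coeff p i * (y ^ i / exp y)) \<longlongrightarrow> (\<Sum>i\<le>degree p. coeff p i * 0)) at_top"
      by (intro tendsto_intros tendsto_power_div_exp_0)
    then have "((\<lambda>y. poly p y * exp (- y)) \<longlongrightarrow> 0) at_top"
      by (simp add: poly_altdef exp_minus divide_inverse sum_distrib_right mult.assoc)
    then show ?thesis
      by (rule filterlim_compose) (simp add: filterlim_inverse_at_top_right flip: inverse_eq_divide)
  qed
  have "(?F p has_real_derivative ?F q x) (at x)" for x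
  proof -
    consider "x < 0" | "x > 0" | "x = 0" by linarith
    then show ?thesis
    proof cases
      case 1
      have "((\<lambda>x. 0) has_real_derivative 0) (at x)" by simp
      then have "(?F p has_real_derivative 0) (at x)"
        by (rule has_field_derivative_transform_within_open[where S = "{..<0}"]) (use 1 in auto)
      then show ?thesis using 1 by simp
    next
      case 2
      have "((\<lambda>x. poly p (1/x) * exp (- (1/x))) has_real_derivative ?F q x) (at x)"
      proof -
        have i: "((\<lambda>x. 1 / x) has_real_derivative - (1/x)\<^sup>2) (at x)"
          using 2 by (auto intro!: derivative_eq_intros simp: power2_eq_square)
        have "((\<lambda>x. poly p (1/x)) has_real_derivative poly (pderiv p) (1/x) * (- (1/x)\<^sup>2)) (at x)"
          by (rule DERIV_chain2[OF poly_DERIV i])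
        moreover have "((\<lambda>x. exp (- (1/x))) has_real_derivative exp (- (1/x)) * (1/x)\<^sup>2) (at x)"
          using DERIV_chain2[OF DERIV_exp DERIV_minus[OF i]] by simp
        ultimately have "((\<lambda>x. poly p (1/x) * exp (- (1/x))) has_real_derivative
            poly (pderiv p) (1/x) * (- (1/x)\<^sup>2) * exp (- (1/x)) + exp (- (1/x)) * (1/x)\<^sup>2 * poly p (1/x)) (at x)"
          by (rule DERIV_mult)
        also have "poly (pderiv p) (1/x) * (- (1/x)\<^sup>2) * exp (- (1/x)) + exp (- (1/x)) * (1/x)\<^sup>2 * poly p (1/x) = ?F q x"
          using 2 by (simp add: q_def algebra_simps power2_eq_square)
        finally show ?thesis .
      qed
      then show ?thesis
        by (rule has_field_derivative_transform_within_open[where S = "{0<..}"]) (use 2 in auto)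
    next
      case 3
      \<comment> \<open>Dividing by y is multiplying by 1/y, so the difference quotient at 0 belongs
        to the same family, with polynomial \<open>[:0,1:] * p\<close>.\<close>
      have "((\<lambda>y. ?F p y / y) \<longlongrightarrow> 0) (at_right 0)"
        by (rule Lim_transform_eventually[OF lim[of "[:0,1:] * p"]])
          (auto simp: eventually_at_right_less  intro!: eventually_mono[OF eventually_at_right_less])
      moreover have "((\<lambda>y. ?F p y / y) \<longlongrightarrow> 0) (at_left 0)"
        by (rule Lim_transform_eventually[OF tendsto_const])
          (auto intro!: eventually_at_leftI[of "-1"])
      ultimately have "((\<lambda>y. ?F p y / y) \<longlongrightarrow> 0) (at 0)"
        using filterlim_split_at by blast
      then show ?thesis using 3 by (simp add: has_field_derivative_iff)
    qed
  qed
  then show ?case unfolding times_differentiable.simps using Suc[of q] by (intro exI[of _ "?F q"]) simp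
qed simp

lemma times_differentiable_inverse:
  assumes "times_differentiable k f" "\<And>x. f x \<noteq> 0"
  shows "times_differentiable k (\<lambda>x. inverse (f x))"
  using assms
proof (induction k arbitrary: f)
  case (Suc k)
  then obtain f' where d: "\<And>x. (f has_real_derivative f' x) (at x)" "times_differentiable k f'"
    by auto
  let ?g = "\<lambda>x. (-1) * (f' x * (inverse (f x) * inverse (f x)))"
  have "((\<lambda>x. inverse (f x)) has_real_derivative ?g x) (at x)" for x
    using DERIV_inverse'[OF d(1) Suc.prems(2), of x] by (simp add: mult_ac)
  moreover have "times_differentiable k ?g"
    by (intro times_differentiable_mult times_differentiable_const d Suc.IH
        times_differentiable_SucD[OF Suc.prems(1)] Suc.prems(2))
  ultimately show ?case unfolding times_differentiable.simps by (intro exI[of _ ?g]) simp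
qed simp

text \<open>One pair serves two purposes: differences of rescaled translates of \<open>H\<close> are
  compactly supported cutoffs, and \<open>h\<close> is a kernel of mass \<open>H 1 - H 0 = 1\<close>
  supported in [0,1], hence generates an approximate identity.\<close>

definition smooth_step :: "(real \<Rightarrow> real) \<Rightarrow> (real \<Rightarrow> real) \<Rightarrow> bool" where
  "smooth_step H h \<longleftrightarrow> (\<forall>k. times_differentiable k H) \<and>
     (\<forall>x. (H has_real_derivative h x) (at x)) \<and> continuous_on UNIV h \<and>
     (\<forall>x\<le>0. H x = 0) \<and> (\<forall>x\<ge>1. H x = 1) \<and> (\<forall>x. H x \<in> {0..1}) \<and> (\<forall>x. x \<notin> {0..1} \<longrightarrow> h x = 0)"

lemma smooth_stepD:
  assumes "smooth_step H h"
  shows "times_differentiable k H" "(H has_real_derivative h x) (at x)" "continuous_on UNIV h"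
    "x \<le> 0 \<Longrightarrow> H x = 0" "x \<ge> 1 \<Longrightarrow> H x = 1" "H x \<in> {0..1}" "x \<notin> {0..1} \<Longrightarrow> h x = 0"
  using assms unfolding smooth_step_def by blast+

text \<open>The classical quotient e(x) / (e(x) + e(1 - x)) with e(x) = exp(-1/x) for positive x and
  0 otherwise. The denominator is positive because x and 1 - x are never both nonpositive.\<close>

lemma ex_smooth_step: "\<exists>H h. smooth_step H h"
proof -
  define e :: "real \<Rightarrow> real" where "e x = (if x > 0 then exp (- (1/x)) else 0)" for x
  \<comment> \<open>1 - x is spelled \<open>-1 * x + 1\<close> to match the form in
    \<open>times_differentiable_affine\<close>.\<close>
  define H where "H x = e x * inverse (e x + e (-1 * x + 1))" for x
  have e: "times_differentiable k e" for k
  proof -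
    have "e = (\<lambda>x. if x > 0 then poly 1 (1/x) * exp (- (1/x)) else 0)"
      by (auto simp: e_def fun_eq_iff)
    then show ?thesis using times_differentiable_exp_inverse[of k 1] by simp
  qed
  have e0: "e x \<ge> 0" for x by (simp add: e_def)
  have pos: "e x + e (-1 * x + 1) > 0" for x
    by (cases "x > 0"; cases "1 - x > 0") (auto simp: e_def add_pos_pos)
  have H: "times_differentiable k H" for k
    unfolding H_def using pos[THEN less_imp_neq]
    by (intro times_differentiable_mult times_differentiable_inverse times_differentiable_add e
        times_differentiable_affine) (metis)
  from H[of "Suc (Suc 0)"] obtain h where h: "\<And>x. (H has_real_derivative h x) (at x)"
    "times_differentiable (Suc 0) h" by auto
  then have c: "continuous_on UNIV h"
    by (meson DERIV_isCont continuous_at_imp_continuous_on times_differentiable.simps(2))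
  have H0: "H x = 0" if "x \<le> 0" for x using that by (simp add: H_def e_def)
  have H1: "H x = 1" if "x \<ge> 1" for x using that by (simp add: H_def e_def)
  have H01: "H x \<in> {0..1}" for x
    using e0[of x] e0[of "-1*x+1"] pos[of x] by (simp add: H_def field_simps)
  have "h x = 0" if x: "x \<notin> {0..1}" for x
  proof (cases "x < 0")
    case True
    have "(H has_real_derivative 0) (at x)"
      by (rule has_field_derivative_transform_within_open[OF DERIV_const, where S = "{..<0}"])
         (use H0 True in auto)
    then show ?thesis using h(1) DERIV_unique by blast
  next
    case False
    have "(H has_real_derivative 0) (at x)"
      by (rule has_field_derivative_transform_within_open[OF DERIV_const, where S = "{1<..}"])
         (use H1 False x in auto)
    then show ?thesis using h(1) DERIV_unique by blast
  qed
  with H h(1) c H0 H1 H01 show ?thesis unfolding smooth_step_def by blast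
qed

subsection \<open>Weak derivatives of continuous functions\<close>

text \<open>The rescaled kernel lives on [a, a + 1/(n+1)] and keeps its mass, so continuity of
  \<open>g\<close> at \<open>a\<close> determines the limit although the kernel is one-sided.
  \<open>Suc n\<close> keeps the scale nonzero.\<close>

lemma approximate_identity_at:
  fixes g :: "real \<Rightarrow> complex"
  assumes g: "continuous_on UNIV g" and h: "continuous_on UNIV h" "\<And>x. x \<notin> {0..1} \<Longrightarrow> h x = 0"
  shows "integrable lebesgue (\<lambda>x. (real (Suc n) * h (real (Suc n) * (x - a))) *\<^sub>R g x)"
    and "(\<lambda>n. LINT x|lebesgue. (real (Suc n) * h (real (Suc n) * (x - a))) *\<^sub>R g x)
      \<longlonglongrightarrow> (LINT x|lborel. h x) *\<^sub>R g a"
proof -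
  define F where "F n x = (real (Suc n) * h (real (Suc n) * (x - a))) *\<^sub>R g x" for n x
  \<comment> \<open>\<open>K\<close> is the integrand after the substitution x = a + y/(n+1); its
    support no longer moves with n, so dominated convergence applies. The substitution is done over
    \<open>lborel\<close> and carried to \<open>lebesgue\<close> by completion.\<close>
  define K where "K n y = h y *\<^sub>R g (a + y / Suc n)" for n y
  have hm: "continuous_on UNIV (\<lambda>x. h (r * (x - a)))" for r
    by (intro continuous_on_compose2[OF h(1)] continuous_intros) auto
  have Fm: "F n \<in> borel_measurable lborel" for n
    unfolding F_def measurable_lborel2
    by (intro borel_measurable_continuous_onI continuous_intros hm g)
  have Km: "K n \<in> borel_measurable lborel" for n
    unfolding K_def measurable_lborel2
    by (intro borel_measurable_continuous_onI continuous_intros h continuous_on_compose2[OF g]) auto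
  have "bounded (h ` {0..1})" "bounded (g ` {a..a+1})"
    by (intro compact_imp_bounded compact_continuous_image continuous_on_subset[OF g]
        continuous_on_subset[OF h(1)]; simp)+
  then obtain Bh Bg where B: "\<And>x. x \<in> {0..1} \<Longrightarrow> norm (h x) \<le> Bh"
    "\<And>x. x \<in> {a..a+1} \<Longrightarrow> norm (g x) \<le> Bg"
    unfolding bounded_iff ball_simps(9) by metis
  have Kb: "norm (K n y) \<le> indicator {0..1} y *\<^sub>R (Bh * Bg)" for n y
  proof (cases "y \<in> {0..1}")
    case True
    then have "y / Suc n \<in> {0..1}" by (auto simp: field_simps)
    then have "norm (g (a + y / Suc n)) \<le> Bg" by (intro B) auto
    with B(1)[OF True] True show ?thesis
      by (simp add: K_def mult_mono order_trans[OF norm_ge_zero])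
  qed (simp add: K_def h)
  have Bi: "integrable lborel (\<lambda>y::real. indicator {0..1} y *\<^sub>R (Bh * Bg))" by simp
  have Ki: "integrable lborel (K n)" for n
    by (rule Bochner_Integration.integrable_bound[OF Bi Km]) (use Kb in \<open>auto intro!: AE_I2 order_trans[OF Kb]\<close>)
  have FK: "F n (a + (1 / Suc n) * y) = Suc n *\<^sub>R K n y" for n y
  proof -
    have "real (Suc n) * (a + (1 / Suc n) * y - a) = y" by simp
    then show ?thesis unfolding F_def K_def by (simp only: scaleR_scaleR times_divide_eq_left mult_1)
  qed
  have Fi: "integrable lborel (F n)" for n
  proof -
    have "1 / real (Suc n) \<noteq> 0" by simp
    from lborel_integrable_real_affine_iff[OF this, of "F n" a] show ?thesis
      unfolding FK using Ki[of n] by simp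
  qed
  then show "integrable lebesgue (\<lambda>x. (real (Suc n) * h (real (Suc n) * (x - a))) *\<^sub>R g x)" for n
    using integrable_completion[OF Fm] unfolding F_def by blast
  have "(LINT x|lebesgue. F n x) = (LINT x|lborel. K n x)" for n
  proof -
    have "1 / real (Suc n) \<noteq> 0" by simp
    from lborel_integral_real_affine[OF this, of "F n" a] show ?thesis
      unfolding FK integral_completion[OF Fm] by simp
  qed
  moreover have "(\<lambda>n. LINT x|lborel. K n x) \<longlonglongrightarrow> (LINT x|lborel. h x *\<^sub>R g a)"
  proof (rule integral_dominated_convergence[OF _ Km Bi])
    show "(\<lambda>y. h y *\<^sub>R g a) \<in> borel_measurable lborel"
      unfolding measurable_lborel2 by (intro borel_measurable_continuous_onI continuous_intros h)
    show "AE y in lborel. (\<lambda>n. K n y) \<longlonglongrightarrow> h y *\<^sub>R g a"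
    proof (rule AE_I2)
      fix y
      have "(\<lambda>n. a + y / Suc n) \<longlonglongrightarrow> a + 0"
        by (intro tendsto_intros tendsto_divide_0[OF tendsto_const] 
            filterlim_at_top_imp_at_infinity filterlim_compose[OF filterlim_real_sequentially filterlim_Suc])
      then show "(\<lambda>n. K n y) \<longlonglongrightarrow> h y *\<^sub>R g a"
        unfolding K_def using continuous_on_tendsto_compose[OF g] by (intro tendsto_intros) auto
    qed
  qed (use Kb in auto)
  moreover have "integrable lborel h"
  proof -
    have "integrable lborel (\<lambda>x. indicator {0..1} x *\<^sub>R h x)"
      by (rule borel_integrable_compact) (auto intro: continuous_on_subset[OF h(1)])
    also have "(\<lambda>x. indicator {0..1} x *\<^sub>R h x) = h"
      using h(2) by (auto simp: indicator_def fun_eq_iff)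
    finally show ?thesis .
  qed
  ultimately show "(\<lambda>n. LINT x|lebesgue. (real (Suc n) * h (real (Suc n) * (x - a))) *\<^sub>R g x)
      \<longlonglongrightarrow> (LINT x|lborel. h x) *\<^sub>R g a"
    unfolding F_def[symmetric] by (simp only: integral_scaleR_left)
qed

text \<open>Testing against smooth approximations of the indicator of an interval: their derivatives
  are an approximate identity at \<open>a\<close> minus one at \<open>b\<close>, so one side of the
  weak identity tends to the increment of \<open>g\<close> and the other to the integral of
  \<open>dg\<close>.\<close>

lemma weak_derivative_has_integral:
  assumes w: "has_weak_derivative g dg" and g: "continuous_on UNIV g" and ab: "a \<le> b"
  shows "(dg has_integral (g b - g a)) {a..b}"
proof -
  obtain H h where "smooth_step H h"
    using ex_smooth_step by blast
  note H = smooth_stepD[OF this]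
  have hint: "(LINT x|lborel. h x) = 1"
  proof -
    have "(LINT x|lborel. indicator {0..1} x *\<^sub>R h x) = H 1 - H 0"
    proof (rule integral_FTC_Icc)
      show "(H has_vector_derivative h x) (at x within {0..1})" for x
        using H(2)[of x] by (simp add: has_real_derivative_iff_has_vector_derivative has_vector_derivative_at_within)
    qed (auto intro: continuous_on_subset[OF H(3)])
    also have "(\<lambda>x. indicator {0..1} x *\<^sub>R h x) = h"
      using H(7) by (auto simp: indicator_def fun_eq_iff)
    finally show ?thesis by (simp add: H(4,5))
  qed
  \<comment> \<open>For a < b and n large, this goes from 0 to 1 just to the right of
    \<open>a\<close> and returns to 0 just to the right of \<open>b\<close>. All of these functions
    vanish outside [a, b+1].\<close>
  define \<phi> where "\<phi> n x = H (Suc n * (x - a)) - H (Suc n * (x - b))" for n x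
  define D where "D c n x = (real (Suc n) * h (real (Suc n) * (x - c))) *\<^sub>R g x" for c n x
  note D = approximate_identity_at[OF g H(3,7), folded D_def]
  have dH: "((\<lambda>x. H (r * (x - c))) has_real_derivative r * h (r * (x - c))) (at x)" for r c x :: real
  proof -
    have "((\<lambda>x. r * (x - c)) has_real_derivative r) (at x)"
      by (auto intro!: derivative_eq_intros)
    from DERIV_chain2[OF H(2) this] show ?thesis by (simp add: mult.commute)
  qed
  have z: "\<phi> n x = 0" if x: "x \<notin> {a..b+1}" for n x
    proof (cases "x < a")
      case True
      then have "Suc n * (x - b) \<le> 0" "Suc n * (x - a) \<le> 0"
        using ab by (intro mult_nonneg_nonpos; simp)+
      then show ?thesis unfolding \<phi>_def by (simp only: H(4))
    next
      case False
      with x ab have "x - b \<ge> 1" "x - a \<ge> 1" by auto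
      then have "1 * 1 \<le> Suc n * (x - b)" "1 * 1 \<le> Suc n * (x - a)" by (intro mult_mono; simp)+
      then show ?thesis unfolding \<phi>_def by (simp only: H(5) mult_1)
    qed
  have test: "test_function (\<phi> n)" for n
  proof (rule test_functionI)
    define r where "r = real (Suc n)"
    have "times_differentiable k (\<lambda>x. H (r * x + (- r * a)) + (- 1) * H (r * x + (- r * b)))" for k
      by (intro times_differentiable_add times_differentiable_mult times_differentiable_const
         times_differentiable_affine H(1))
    also have "(\<lambda>x. H (r * x + (- r * a)) + (- 1) * H (r * x + (- r * b))) = \<phi> n"
    proof -
      have eq: "r * x + (- r * c) = r * (x - c)" for r x c :: real
        by (simp add: right_diff_distrib)
      show ?thesis unfolding \<phi>_def[abs_def] eq r_def by simp
    qed
    finally show "times_differentiable k (\<phi> n)" for k .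
  qed (rule z)
  have "deriv (\<phi> n) x *\<^sub>R g x = D a n x - D b n x" for n x
  proof -
    have "deriv (\<phi> n) x = Suc n * h (Suc n * (x - a)) - Suc n * h (Suc n * (x - b))"
      unfolding \<phi>_def by (intro DERIV_imp_deriv DERIV_diff dH)
    then show ?thesis unfolding D_def by (simp add: scaleR_left_diff_distrib)
  qed
  then have 1: "(LINT x|lebesgue. \<phi> n x *\<^sub>R dg x) = (LINT x|lebesgue. D b n x) - (LINT x|lebesgue. D a n x)" for n
  proof -
    have "(LINT x|lebesgue. \<phi> n x *\<^sub>R dg x) = - (LINT x|lebesgue. deriv (\<phi> n) x *\<^sub>R g x)"
      using w test[of n] unfolding has_weak_derivative_def by simp
    also have "(LINT x|lebesgue. deriv (\<phi> n) x *\<^sub>R g x) = (LINT x|lebesgue. D a n x - D b n x)"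
      using \<open>\<And>n x. deriv (\<phi> n) x *\<^sub>R g x = D a n x - D b n x\<close> by simp
    also have "\<dots> = (LINT x|lebesgue. D a n x) - (LINT x|lebesgue. D b n x)"
      by (rule Bochner_Integration.integral_diff[OF D(1) D(1)])
    finally show ?thesis by simp
  qed
  have "(\<lambda>n. LINT x|lebesgue. \<phi> n x *\<^sub>R dg x) \<longlonglongrightarrow> g b - g a"
    unfolding 1 using tendsto_diff[OF D(2)[of b] D(2)[of a]] by (simp add: hint)
  moreover
  have loc: "dg absolutely_integrable_on {c..d}" for c d
    using w unfolding has_weak_derivative_def locally_integrable_def by auto
  \<comment> \<open>The limit interval is half-open because \<open>H 0 = 0\<close>: for a < b the
    functions tend to 0 at \<open>a\<close> and to 1 at \<open>b\<close>. Adding the point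
    \<open>a\<close> afterwards changes no integral.\<close>
  have "(\<lambda>n. LINT x|lebesgue. \<phi> n x *\<^sub>R dg x) \<longlonglongrightarrow> (LINT x|lebesgue. indicator {a<..b} x *\<^sub>R dg x)"
  proof (rule integral_dominated_convergence)
    \<comment> \<open>Only local integrability of \<open>dg\<close> is available, so measurability
      and the dominating function both come from the common support [a, b+1].\<close>
    define E where "E x = indicat_real {a..b+1} x *\<^sub>R dg x" for x
    have E: "integrable lebesgue E"
      using loc[of a "b+1"] unfolding set_integrable_def E_def .
    then have Em: "E \<in> borel_measurable lebesgue" by (rule borel_measurable_integrable)
    have "(\<lambda>x. indicat_real {a<..b} x *\<^sub>R E x) \<in> borel_measurable lebesgue"
      by (intro borel_measurable_scaleR Em borel_measurable_indicator) auto
    also have "(\<lambda>x. indicat_real {a<..b} x *\<^sub>R E x) = (\<lambda>x. indicat_real {a<..b} x *\<^sub>R dg x)"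
      by (auto simp: indicator_def E_def fun_eq_iff)
    finally show "(\<lambda>x. indicat_real {a<..b} x *\<^sub>R dg x) \<in> borel_measurable lebesgue" .
    show "integrable lebesgue (\<lambda>x. norm (indicat_real {a..b+1} x *\<^sub>R dg x))"
      using integrable_norm[OF E] unfolding E_def .
    have c: "continuous_on UNIV (\<phi> n)" for n
      unfolding \<phi>_def
      by (intro continuous_on_diff continuous_at_imp_continuous_on ballI DERIV_isCont[OF dH])
    have "(\<lambda>x. \<phi> n x *\<^sub>R E x) \<in> borel_measurable lebesgue" for n
      by (intro borel_measurable_scaleR Em measurable_completion)
        (simp add: c borel_measurable_continuous_onI)
    moreover have "(\<lambda>x. \<phi> n x *\<^sub>R E x) = (\<lambda>x. \<phi> n x *\<^sub>R dg x)" for n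
      using z by (auto simp: indicator_def E_def fun_eq_iff)
    ultimately show "(\<lambda>x. \<phi> n x *\<^sub>R dg x) \<in> borel_measurable lebesgue" for n by metis
    have "\<bar>\<phi> n x\<bar> \<le> indicator {a..b+1} x" for n x
      using z[of x n] H(6)[of "Suc n * (x - a)"] H(6)[of "Suc n * (x - b)"] 
      by (auto simp: indicator_def \<phi>_def)
    then show "AE x in lebesgue. norm (\<phi> n x *\<^sub>R dg x) \<le> norm (indicat_real {a..b+1} x *\<^sub>R dg x)" for n
      by (auto intro!: AE_I2 mult_right_mono)
    have step: "(\<lambda>n. H (Suc n * y)) \<longlonglongrightarrow> (if y > 0 then 1 else 0)" for y :: real
    proof (cases "y > 0")
      case True
      obtain N where "1 / y < real N" using reals_Archimedean2 by blast
      then have "1 \<le> Suc n * y" if "n \<ge> N" for n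
      proof -
        have "1 < real N * y" using True \<open>1 / y < real N\<close> by (simp add: field_simps)
        also have "\<dots> \<le> Suc n * y" using True that by (intro mult_right_mono) auto
        finally show ?thesis by simp
      qed
      then have "eventually (\<lambda>n. H (Suc n * y) = 1) sequentially"
        unfolding eventually_sequentially using H(5) by blast
      then show ?thesis using True by (simp add: tendsto_eventually)
    next
      case False
      then have "H (Suc n * y) = 0" for n by (intro H(4) mult_nonneg_nonpos) auto
      then show ?thesis using False by simp
    qed
    show "AE x in lebesgue. (\<lambda>n. \<phi> n x *\<^sub>R dg x) \<longlonglongrightarrow> indicator {a<..b} x *\<^sub>R dg x"
    proof (intro AE_I2 tendsto_scaleR tendsto_const)
      fix x
      have "indicator {a<..b} x = (if x - a > 0 then 1 else 0) - (if x - b > 0 then 1::real else 0)"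
        using ab by (auto simp: indicator_def)
      then show "(\<lambda>n. \<phi> n x) \<longlonglongrightarrow> indicator {a<..b} x"
        unfolding \<phi>_def by (simp only:) (intro tendsto_diff step)
    qed
  qed
  moreover have "(LINT x|lebesgue. indicator {a<..b} x *\<^sub>R dg x) = integral {a..b} dg"
  proof -
    have sub: "set_integrable lebesgue {a<..b} dg"
      by (rule set_integrable_subset[OF loc[of a b]]) auto
    have "(LINT x|lebesgue. indicator {a<..b} x *\<^sub>R dg x) = integral {a<..b} dg"
      using set_lebesgue_integral_eq_integral(2)[OF sub] unfolding set_lebesgue_integral_def .
    also have "\<dots> = integral {a..b} dg"
      by (rule integral_spike_set) (rule negligible_subset[OF negligible_sing[of a]], auto)+
    finally show ?thesis .
  qed
  ultimately have "integral {a..b} dg = g b - g a"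
    using LIMSEQ_unique by metis
  then show ?thesis
    using set_lebesgue_integral_eq_integral(1)[OF loc[of a b]] integrable_integral by metis
qed

subsection \<open>The Fourier transform of a function in $W^{1,1}$\<close>

lemma integrable_mult_continuous_bounded:
  fixes f :: "real \<Rightarrow> complex" and \<psi> :: "real \<Rightarrow> complex"
  assumes f: "integrable lebesgue f" and c: "continuous_on UNIV \<psi>" and b: "\<And>x. norm (\<psi> x) \<le> K"
  shows "integrable lebesgue (\<lambda>x. \<psi> x * f x)"
proof (rule Bochner_Integration.integrable_bound)
  show "integrable lebesgue (\<lambda>x. K * norm (f x))" using f by simp
  have "\<psi> \<in> borel_measurable lebesgue"
    by (intro measurable_completion) (simp add: c borel_measurable_continuous_onI)
  then show "(\<lambda>x. \<psi> x * f x) \<in> borel_measurable lebesgue"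
    using borel_measurable_integrable[OF f] by (rule borel_measurable_times)
  have "norm (\<psi> x * f x) \<le> norm (K * norm (f x))" for x
    using b[of x] order_trans[OF norm_ge_zero b[of x]] by (simp add: norm_mult mult_right_mono abs_mult)
  then show "AE x in lebesgue. norm (\<psi> x * f x) \<le> norm (K * norm (f x))" by simp
qed

text \<open>Dominated convergence, the exponential having modulus 1. Continuity is what lets point
  values of the transform be recovered from its weak derivative.\<close>

lemma continuous_on_fourier:
  assumes f: "integrable lebesgue f"
  shows "continuous_on UNIV (fourier f)"
proof (rule continuous_on_sequentiallyI)
  fix u :: "nat \<Rightarrow> real" and a assume u: "u \<longlonglongrightarrow> a"
  have i: "integrable lebesgue (\<lambda>x. exp (- (\<i> * complex_of_real (x * \<xi>))) * f x)" for \<xi>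
    by (rule integrable_mult_continuous_bounded[OF f, where K = 1])
       (auto intro!: continuous_intros simp: norm_exp_eq_Re)
  show "(\<lambda>n. fourier f (u n)) \<longlonglongrightarrow> fourier f a"
    unfolding fourier_def
  proof (rule integral_dominated_convergence)
    show "integrable lebesgue (\<lambda>x. norm (f x))" using f by simp
    show "AE x in lebesgue. (\<lambda>n. exp (- (\<i> * complex_of_real (x * u n))) * f x)
        \<longlonglongrightarrow> exp (- (\<i> * complex_of_real (x * a))) * f x"
      by (intro AE_I2 tendsto_intros u)
    show "AE x in lebesgue. norm (exp (- (\<i> * complex_of_real (x * u n))) * f x) \<le> norm (f x)" for n
      by (simp add: norm_mult norm_exp_eq_Re)
  qed (rule borel_measurable_integrable[OF i])+
qed

text \<open>Compact support of the test function is traded for integrability of \<open>f\<close> and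
  \<open>g\<close>: cut off at distance n and pass to the limit. The transition layers have width 1,
  so derivatives of the cutoffs are bounded uniformly in n, and the layers leave every fixed
  point.\<close>

lemma weak_derivative_bounded_test:
  assumes w: "has_weak_derivative f g" and f: "integrable lebesgue f" and g: "integrable lebesgue g"
    and \<psi>: "\<And>k. times_differentiable k \<psi>" "\<And>x. (\<psi> has_real_derivative \<psi>' x) (at x)"
      "continuous_on UNIV \<psi>'" "\<And>x. \<bar>\<psi> x\<bar> \<le> K" "\<And>x. \<bar>\<psi>' x\<bar> \<le> K'"
  shows "(LINT x|lebesgue. \<psi>' x *\<^sub>R f x) = - (LINT x|lebesgue. \<psi> x *\<^sub>R g x)"
proof -
  obtain H h where "smooth_step H h"
    using ex_smooth_step by blast
  note H = smooth_stepD[OF this]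
  have "bounded (h ` {0..1})"
    by (intro compact_imp_bounded compact_continuous_image continuous_on_subset[OF H(3)]; simp)
  then obtain B where B: "\<forall>x\<in>{0..1}. \<bar>h x\<bar> \<le> B"
    unfolding bounded_iff by auto
  have hB: "\<bar>h x\<bar> \<le> B" for x
  proof (cases "x \<in> {0..1}")
    case False
    have "0 \<le> \<bar>h 0\<bar>" "\<bar>h 0\<bar> \<le> B" using B by simp_all
    then show ?thesis using H(7)[OF False] by simp
  qed (use B in simp)
  \<comment> \<open>Equal to 1 on [-n, n] and to 0 outside [-(n+1), n+1].\<close>
  define cut where "cut n x = H (x + (real n + 1)) + (-1) * H (x + - real n)" for n x
  define cut' where "cut' n x = h (x + (real n + 1)) - h (x + - real n)" for n x
  have Hsh: "((\<lambda>x. H (x + c)) has_real_derivative h (x + c)) (at x)" for c x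
    using H(2)[of "x + c"] by (simp add: DERIV_shift)
  have dcut: "(cut n has_real_derivative cut' n x) (at x)" for n x
    unfolding cut_def[abs_def] cut'_def
    using DERIV_add[OF Hsh[of "real n + 1" x] DERIV_cmult[OF Hsh[of "- real n" x], of "-1"]] by simp
  have cut': "continuous_on UNIV (cut' n)" for n
    unfolding cut'_def[abs_def]
    by (intro continuous_on_diff continuous_on_compose2[OF H(3)] continuous_intros) auto
  have cont: "continuous_on UNIV (cut n)" "continuous_on UNIV \<psi>" for n
    using dcut \<psi>(2) by (meson DERIV_isCont continuous_at_imp_continuous_on)+
  have cut1: "\<bar>cut n x\<bar> \<le> 1" for n x
    using H(6)[of "x + (real n + 1)"] H(6)[of "x + - real n"] by (simp add: cut_def abs_le_iff)
  have cut'1: "\<bar>cut' n x\<bar> \<le> 2 * B" for n x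
    using hB[of "x + (real n + 1)"] hB[of "x + - real n"] unfolding cut'_def by linarith
  have ev: "eventually (\<lambda>n. cut n x = 1 \<and> cut' n x = 0) sequentially" for x
  proof -
    obtain N where N: "\<bar>x\<bar> < real N" using reals_Archimedean2 by blast
    have "cut n x = 1 \<and> cut' n x = 0" if "n \<ge> N" for n
    proof -
      have "x + (real n + 1) > 1" "x + - real n < 0" using N that by linarith+
      then show ?thesis by (simp add: cut_def cut'_def H(4,5,7))
    qed
    then show ?thesis unfolding eventually_sequentially by blast
  qed
  have test: "test_function (\<lambda>x. \<psi> x * cut n x)" for n
  proof (rule test_functionI)
    have "times_differentiable k (\<lambda>x. H (1 * x + c))" for k c
      by (intro times_differentiable_affine H(1))
    then have "times_differentiable k (\<lambda>x. H (x + c))" for k c by simp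
    then show "times_differentiable k (\<lambda>x. \<psi> x * cut n x)" for k
      unfolding cut_def[abs_def]
      by (intro times_differentiable_mult times_differentiable_add times_differentiable_const \<psi>(1))
    fix x assume x: "x \<notin> {- (real n + 1) .. real n + 1}"
    have "x + (real n + 1) \<le> 0 \<and> x + - real n \<le> 0 \<or> x + (real n + 1) \<ge> 1 \<and> x + - real n \<ge> 1"
      using x by auto
    then show "\<psi> x * cut n x = 0" by (auto simp: cut_def H(4,5))
  qed
  define D where "D n x = \<psi>' x * cut n x + cut' n x * \<psi> x" for n x
  have Dc: "continuous_on UNIV (D n)" for n
    unfolding D_def[abs_def] by (intro continuous_intros cont cut' \<psi>(3))
  have D: "deriv (\<lambda>x. \<psi> x * cut n x) x = D n x" for n x
    unfolding D_def by (rule DERIV_imp_deriv[OF DERIV_mult[OF \<psi>(2) dcut]])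
  have eq: "(LINT x|lebesgue. D n x *\<^sub>R f x) = - (LINT x|lebesgue. (\<psi> x * cut n x) *\<^sub>R g x)" for n
  proof -
    have "(LINT x|lebesgue. deriv (\<lambda>x. \<psi> x * cut n x) x *\<^sub>R f x) = - (LINT x|lebesgue. (\<psi> x * cut n x) *\<^sub>R g x)"
      using w test[of n] unfolding has_weak_derivative_def by blast
    then show ?thesis unfolding D .
  qed
  have K: "0 \<le> K" "0 \<le> K'" "0 \<le> B"
    using \<psi>(4,5)[of 0] hB[of 0] by linarith+
  have m: "(\<lambda>x. a x *\<^sub>R u x) \<in> borel_measurable lebesgue"
    if "continuous_on UNIV a" "integrable lebesgue u" for a :: "real \<Rightarrow> real" and u :: "real \<Rightarrow> complex"
    by (intro borel_measurable_scaleR borel_measurable_integrable[OF that(2)] measurable_completion)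
      (simp add: that borel_measurable_continuous_onI)
  have "(\<lambda>n. LINT x|lebesgue. D n x *\<^sub>R f x) \<longlonglongrightarrow> (LINT x|lebesgue. \<psi>' x *\<^sub>R f x)"
  proof (rule integral_dominated_convergence)
    show "integrable lebesgue (\<lambda>x. (K' + 2 * B * K) * norm (f x))" using f by simp
    have "\<bar>D n x\<bar> \<le> K' * 1 + 2 * B * K" for n x
      unfolding D_def using \<psi>(4,5) cut1 cut'1 K
      by (intro order_trans[OF abs_triangle_ineq] add_mono) (auto simp only: abs_mult intro!: mult_mono abs_ge_zero)
    then show "AE x in lebesgue. norm (D n x *\<^sub>R f x) \<le> (K' + 2 * B * K) * norm (f x)" for n
      by (simp add: mult_right_mono)
    show "AE x in lebesgue. (\<lambda>n. D n x *\<^sub>R f x) \<longlonglongrightarrow> \<psi>' x *\<^sub>R f x"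
    proof (rule AE_I2)
      fix x
      show "(\<lambda>n. D n x *\<^sub>R f x) \<longlonglongrightarrow> \<psi>' x *\<^sub>R f x"
        by (intro tendsto_eventually eventually_mono[OF ev[of x]]) (simp add: D_def)
    qed
  qed (intro m f \<psi>(3) Dc)+
  moreover have "(\<lambda>n. LINT x|lebesgue. (\<psi> x * cut n x) *\<^sub>R g x) \<longlonglongrightarrow> (LINT x|lebesgue. \<psi> x *\<^sub>R g x)"
  proof (rule integral_dominated_convergence)
    show "integrable lebesgue (\<lambda>x. K * norm (g x))" using g by simp
    have "\<bar>\<psi> x * cut n x\<bar> \<le> K * 1" for n x
      unfolding abs_mult using \<psi>(4) cut1 K by (intro mult_mono) auto
    then show "AE x in lebesgue. norm ((\<psi> x * cut n x) *\<^sub>R g x) \<le> K * norm (g x)" for n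
      by (simp add: mult_right_mono)
    show "AE x in lebesgue. (\<lambda>n. (\<psi> x * cut n x) *\<^sub>R g x) \<longlonglongrightarrow> \<psi> x *\<^sub>R g x"
    proof (rule AE_I2)
      fix x
      show "(\<lambda>n. (\<psi> x * cut n x) *\<^sub>R g x) \<longlonglongrightarrow> \<psi> x *\<^sub>R g x"
        by (intro tendsto_eventually eventually_mono[OF ev[of x]]) simp
    qed
  qed (intro m g continuous_intros cont)+
  ultimately show ?thesis
    unfolding eq using LIMSEQ_unique tendsto_minus by blast
qed

text \<open>Multiplying the transform by the frequency amounts to transforming the weak derivative.
  Test functions are real, so the exponential is split into cosine and sine; this costs a factor 2
  in \<open>B\<close>, which only serves to kill a boundary term.\<close>

lemma fourier_decay:
  assumes "f \<in> W11"
  obtains B where "\<And>\<xi>. \<bar>\<xi>\<bar> * norm (fourier f \<xi>) \<le> B"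
proof -
  obtain g where f: "integrable lebesgue f" and g: "integrable lebesgue g" and w: "has_weak_derivative f g"
    using assms unfolding W11_def by blast
  have "\<bar>\<xi>\<bar> * norm (fourier f \<xi>) \<le> 2 * (LINT x|lebesgue. norm (g x))" for \<xi>
  proof -
    let ?c = "\<lambda>x. cos (\<xi> * x)" and ?s = "\<lambda>x. sin (\<xi> * x)"
    have td: "times_differentiable k ?c" "times_differentiable k ?s" for k
      using times_differentiable_cos_sin[of k 1 \<xi> 0] times_differentiable_cos_sin[of k 0 \<xi> 1] by simp_all
    have b: "\<bar>- \<xi> * ?s x\<bar> \<le> \<bar>\<xi>\<bar>" "\<bar>\<xi> * ?c x\<bar> \<le> \<bar>\<xi>\<bar>" for x
      using abs_sin_le_one[of "\<xi> * x"] abs_cos_le_one[of "\<xi> * x"] by (simp_all add: abs_mult mult_left_le)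
    have d: "(?c has_real_derivative - \<xi> * ?s x) (at x)" "(?s has_real_derivative \<xi> * ?c x) (at x)" for x
      by (auto intro!: derivative_eq_intros)
    have cont: "continuous_on UNIV ?c" "continuous_on UNIV ?s"
      by (intro continuous_intros)+
    have e1: "(LINT x|lebesgue. (- \<xi> * ?s x) *\<^sub>R f x) = - (LINT x|lebesgue. ?c x *\<^sub>R g x)"
      by (rule weak_derivative_bounded_test[OF w f g td(1) d(1) _ _ b(1)])
         (auto intro!: continuous_intros abs_cos_le_one)
    have e2: "(LINT x|lebesgue. (\<xi> * ?c x) *\<^sub>R f x) = - (LINT x|lebesgue. ?s x *\<^sub>R g x)"
      by (rule weak_derivative_bounded_test[OF w f g td(2) d(2) _ _ b(2)])
         (auto intro!: continuous_intros abs_sin_le_one)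
    have int: "integrable lebesgue (\<lambda>x. complex_of_real (a x) * u x)"
      if "continuous_on UNIV a" "\<And>x. \<bar>a x\<bar> \<le> 1" "integrable lebesgue u" for a and u :: "real \<Rightarrow> complex"
      by (rule integrable_mult_continuous_bounded[OF that(3), where K = 1])
        (use that in \<open>auto intro!: continuous_intros\<close>)
    have "fourier f \<xi> = (LINT x|lebesgue. ?c x *\<^sub>R f x - \<i> * (?s x *\<^sub>R f x))"
      unfolding fourier_def
    proof (rule Bochner_Integration.integral_cong[OF refl])
      fix x
      have "exp (- (\<i> * complex_of_real (x * \<xi>))) = cis (- (\<xi> * x))"
        by (simp add: cis_conv_exp mult.commute)
      also have "\<dots> = of_real (?c x) - \<i> * of_real (?s x)"
        by (simp add: complex_eq_iff)
      finally show "exp (- (\<i> * complex_of_real (x * \<xi>))) * f x = ?c x *\<^sub>R f x - \<i> * (?s x *\<^sub>R f x)"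
        by (simp only: left_diff_distrib scaleR_conv_of_real mult.assoc)
    qed
    also have "\<dots> = (LINT x|lebesgue. ?c x *\<^sub>R f x) - \<i> * (LINT x|lebesgue. ?s x *\<^sub>R f x)"
      using int[OF cont(1) abs_cos_le_one f] int[OF cont(2) abs_sin_le_one f]
      by (subst Bochner_Integration.integral_diff) (simp_all add: scaleR_conv_of_real)
    finally have e3: "\<xi> *\<^sub>R fourier f \<xi> = (LINT x|lebesgue. (\<xi> * ?c x) *\<^sub>R f x) + \<i> * (LINT x|lebesgue. (- \<xi> * ?s x) *\<^sub>R f x)"
      by (simp add: scaleR_right_diff_distrib flip: scaleR_scaleR)
    have e: "\<xi> *\<^sub>R fourier f \<xi> = - (LINT x|lebesgue. ?s x *\<^sub>R g x) - \<i> * (LINT x|lebesgue. ?c x *\<^sub>R g x)"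
      unfolding e3 e1 e2 by simp
    have n: "norm (LINT x|lebesgue. a x *\<^sub>R g x) \<le> (LINT x|lebesgue. norm (g x))"
      if "continuous_on UNIV a" "\<And>x. \<bar>a x\<bar> \<le> 1" for a :: "real \<Rightarrow> real"
    proof -
      have "norm (LINT x|lebesgue. a x *\<^sub>R g x) \<le> (LINT x|lebesgue. norm (a x *\<^sub>R g x))"
        by (rule integral_norm_bound)
      also have "\<dots> \<le> (LINT x|lebesgue. norm (g x))"
      proof (rule integral_mono)
        show "integrable lebesgue (\<lambda>x. norm (a x *\<^sub>R g x))"
          using integrable_norm[OF int[OF that g]] by (simp add: norm_mult)
        show "norm (a x *\<^sub>R g x) \<le> norm (g x)" for x
          using that(2)[of x] by (simp add: mult_left_le_one_le)
      qed (use g in simp)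
      finally show ?thesis .
    qed
    have "\<bar>\<xi>\<bar> * norm (fourier f \<xi>) = norm (\<xi> *\<^sub>R fourier f \<xi>)" by simp
    also have "\<dots> \<le> norm (LINT x|lebesgue. ?s x *\<^sub>R g x) + norm (LINT x|lebesgue. ?c x *\<^sub>R g x)"
      unfolding e by (rule order_trans[OF norm_triangle_ineq4]) (simp add: norm_mult)
    also have "\<dots> \<le> 2 * (LINT x|lebesgue. norm (g x))"
      using n[OF cont(2)] n[OF cont(1)] by simp
    finally show ?thesis .
  qed
  then show thesis by (rule that)
qed

subsection \<open>Van der Corput's second derivative test\<close>

text \<open>First derivative test. Integrating by parts against 1 / (i \<open>\<theta>'\<close>)
  leaves a remainder of modulus \<open>\<theta>'' / \<theta>'^2\<close>. Convexity makes this the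
  exact derivative of \<open>- 1 / \<theta>'\<close>, so its integral is controlled by the endpoints
  alone.\<close>

lemma norm_integral_cis_le_inverse_deriv:
  assumes ab: "a \<le> b"
    and d1: "\<And>x. x \<in> {a..b} \<Longrightarrow> (\<theta> has_real_derivative \<theta>' x) (at x)"
    and d2: "\<And>x. x \<in> {a..b} \<Longrightarrow> (\<theta>' has_real_derivative \<theta>'' x) (at x)"
    and convex: "\<And>x. x \<in> {a..b} \<Longrightarrow> 0 \<le> \<theta>'' x"
    and m: "m > 0" "\<And>x. x \<in> {a..b} \<Longrightarrow> m \<le> \<bar>\<theta>' x\<bar>"
  shows "norm (integral {a..b} (\<lambda>x. cis (\<theta> x))) \<le> 4 / m"
proof -
  define F where "F x = cis (\<theta> x) * (- \<i> * of_real (1 / \<theta>' x))" for x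
  define R where "R x = \<theta>'' x / (\<theta>' x)\<^sup>2" for x
  have nz: "\<theta>' x \<noteq> 0" if "x \<in> {a..b}" for x using m that by force
  have dinv: "((\<lambda>x. 1 / \<theta>' x) has_real_derivative - R x) (at x)" if "x \<in> {a..b}" for x
    using DERIV_inverse'[OF d2[OF that] nz[OF that]] 
    by (simp add: R_def inverse_eq_divide power2_eq_square)
  have dcis: "((\<lambda>x. cis (\<theta> x)) has_vector_derivative of_real (\<theta>' x) * (\<i> * cis (\<theta> x))) (at x within {a..b})"
    if "x \<in> {a..b}" for x
  proof -
    have "(\<theta> has_derivative (\<lambda>h. \<theta>' x * h)) (at x within {a..b})"
      using d1[OF that] has_field_derivative_def has_derivative_at_withinI by blast
    from has_derivative_cis[OF this] show ?thesis
      by (simp add: has_vector_derivative_def scaleR_conv_of_real mult_ac)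
  qed
  have "(F has_vector_derivative cis (\<theta> x) + cis (\<theta> x) * (\<i> * of_real (R x))) (at x within {a..b})"
    if "x \<in> {a..b}" for x
  proof -
    have "((\<lambda>x. of_real (1 / \<theta>' x) :: complex) has_vector_derivative of_real (- R x)) (at x within {a..b})"
      using dinv[OF that] by (intro has_vector_derivative_of_real) 
        (simp add: has_real_derivative_iff_has_vector_derivative has_vector_derivative_at_within)
    from has_vector_derivative_mult[OF dcis[OF that] has_vector_derivative_mult_right[OF this, of "- \<i>"]]
    show ?thesis unfolding F_def
      by (rule has_vector_derivative_eq_rhs) (use nz[OF that] in \<open>simp add: field_simps\<close>)
  qed
  then have F: "((\<lambda>x. cis (\<theta> x) + cis (\<theta> x) * (\<i> * of_real (R x))) has_integral (F b - F a)) {a..b}"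
    by (rule fundamental_theorem_of_calculus[OF ab])
  have "continuous_on {a..b} (\<lambda>x. cis (\<theta> x))"
    by (intro continuous_on_cis DERIV_continuous_on[OF has_field_derivative_at_within[OF d1]])
  then have ci: "(\<lambda>x. cis (\<theta> x)) integrable_on {a..b}" by (rule integrable_continuous_real)
  have Ri: "(R has_integral (1 / \<theta>' a - 1 / \<theta>' b)) {a..b}"
  proof -
    have "((\<lambda>x. - (1 / \<theta>' x)) has_vector_derivative R x) (at x within {a..b})" if "x \<in> {a..b}" for x
      using DERIV_minus[OF dinv[OF that]]
      by (simp add: has_real_derivative_iff_has_vector_derivative has_vector_derivative_at_within)
    from fundamental_theorem_of_calculus[OF ab this] show ?thesis by simp
  qed
  have CRi: "(\<lambda>x. cis (\<theta> x) * (\<i> * of_real (R x))) integrable_on {a..b}"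
    using integrable_diff[OF has_integral_integrable[OF F] ci] by simp
  have "norm (integral {a..b} (\<lambda>x. cis (\<theta> x) * (\<i> * of_real (R x)))) \<le> integral {a..b} R"
    by (rule integral_norm_bound_integral[OF CRi has_integral_integrable[OF Ri]])
       (use convex in \<open>auto simp: norm_mult norm_divide norm_power R_def\<close>)
  moreover have "integral {a..b} (\<lambda>x. cis (\<theta> x)) = F b - F a - integral {a..b} (\<lambda>x. cis (\<theta> x) * (\<i> * of_real (R x)))"
    using integral_unique[OF F] integral_add[OF ci CRi] by (simp add: algebra_simps)
  ultimately have "norm (integral {a..b} (\<lambda>x. cis (\<theta> x))) \<le> norm (F b) + norm (F a) + (1 / \<theta>' a - 1 / \<theta>' b)"
    using integral_unique[OF Ri] norm_triangle_ineq4 by (smt (verit))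
  also have "\<dots> = 1 / \<bar>\<theta>' b\<bar> + 1 / \<bar>\<theta>' a\<bar> + (1 / \<theta>' a - 1 / \<theta>' b)"
    by (simp add: F_def norm_mult norm_divide)
  \<comment> \<open>The boundary values and the integrated remainder each contribute at most the sum
    of the two endpoint terms; with every term at most \<open>1 / m\<close>, this gives the
    4.\<close>
  also have "\<dots> \<le> 2 * (1 / \<bar>\<theta>' b\<bar> + 1 / \<bar>\<theta>' a\<bar>)"
    using abs_le_D1[of "1 / \<theta>' a" "1 / \<bar>\<theta>' a\<bar>"] abs_le_D2[of "1 / \<theta>' b" "1 / \<bar>\<theta>' b\<bar>"] by simp
  also have "\<dots> \<le> 2 * (1 / m + 1 / m)"
    using m ab nz[of a] nz[of b] m(2)[of a] m(2)[of b]
    by (intro mult_left_mono add_mono divide_left_mono mult_pos_pos) auto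
  finally show ?thesis by simp
qed

lemma norm_integral_cis_le_length:
  assumes "a \<le> b" "continuous_on {a..b} \<theta>"
  shows "norm (integral {a..b} (\<lambda>x. cis (\<theta> x))) \<le> b - a"
proof -
  have "norm (integral {a..b} (\<lambda>x. cis (\<theta> x))) \<le> 1 * (b - a)"
    by (rule integral_bound) (use assms in \<open>auto intro!: continuous_intros\<close>)
  then show ?thesis by simp
qed

text \<open>\<open>\<theta>'\<close> increases with slope at least \<open>L\<close>, so it is small
  only near its single possible zero. That neighbourhood is estimated by its length, the rest by the
  first derivative test. The cost is 1 + 4 units of \<open>1 / sqrt L\<close> on each side of the
  zero, hence 10.\<close>

lemma van_der_Corput_second_derivative:
  assumes ab: "a \<le> b"
    and d1: "\<And>x. x \<in> {a..b} \<Longrightarrow> (\<theta> has_real_derivative \<theta>' x) (at x)"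
    and d2: "\<And>x. x \<in> {a..b} \<Longrightarrow> (\<theta>' has_real_derivative \<theta>'' x) (at x)"
    and L: "L > 0" "\<And>x. x \<in> {a..b} \<Longrightarrow> L \<le> \<theta>'' x"
  shows "norm (integral {a..b} (\<lambda>x. cis (\<theta> x))) \<le> 10 / sqrt L"
proof -
  \<comment> \<open>This radius balances the length bound \<open>\<delta>\<close> against the bound
    \<open>4 / (L * \<delta>)\<close> away from the zero, since
    \<open>L * \<delta> = sqrt L\<close>.\<close>
  define \<delta> where "\<delta> = 1 / sqrt L"
  have \<delta>: "\<delta> > 0" "4 / sqrt L = 4 * \<delta>" "10 / sqrt L = 10 * \<delta>"
    using L(1) by (simp_all add: \<delta>_def)
  have L\<delta>: "L * \<delta> = sqrt L"
    using real_div_sqrt[of L] L(1) by (simp add: \<delta>_def)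
  have cont: "continuous_on {c..d} \<theta>" if "{c..d} \<subseteq> {a..b}" for c d
    by (rule DERIV_continuous_on[OF has_field_derivative_at_within[OF d1]]) (use that in auto)
  have ci: "(\<lambda>x. cis (\<theta> x)) integrable_on {c..d}" if "{c..d} \<subseteq> {a..b}" for c d
    by (intro integrable_continuous_real continuous_on_cis cont that)
  have slope: "L * (y - x) \<le> \<theta>' y - \<theta>' x" if "a \<le> x" "x \<le> y" "y \<le> b" for x y
  proof (cases "x < y")
    case True
    from MVT2[OF this, of \<theta>' \<theta>''] d2 that obtain z where
      z: "x < z" "z < y" "\<theta>' y - \<theta>' x = (y - x) * \<theta>'' z" by auto
    have "(y - x) * L \<le> (y - x) * \<theta>'' z" using that z L(2)[of z] by (intro mult_left_mono) auto
    with z show ?thesis by (simp add: mult.commute)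
  qed (use that in auto)
  have near: "norm (integral {c..d} (\<lambda>x. cis (\<theta> x))) \<le> 4 * \<delta>"
    if "a \<le> c" "c \<le> d" "d \<le> b" "\<And>x. x \<in> {c..d} \<Longrightarrow> sqrt L \<le> \<bar>\<theta>' x\<bar>" for c d
    unfolding \<delta>(2)[symmetric]
  proof (rule norm_integral_cis_le_inverse_deriv[OF that(2), where \<theta>' = \<theta>' and \<theta>'' = \<theta>''])
    fix x assume x: "x \<in> {c..d}"
    then have x': "x \<in> {a..b}" using that(1,3) by auto
    show "(\<theta> has_real_derivative \<theta>' x) (at x)" "(\<theta>' has_real_derivative \<theta>'' x) (at x)"
      by (rule d1[OF x'] d2[OF x'])+
    show "0 \<le> \<theta>'' x" using L(1) L(2)[OF x'] by simp
    show "sqrt L \<le> \<bar>\<theta>' x\<bar>" by (rule that(4)[OF x])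
  qed (use L(1) in simp)
  have split: "norm (integral {c..d} (\<lambda>x. cis (\<theta> x))) \<le>
      norm (integral {c..e} (\<lambda>x. cis (\<theta> x))) + norm (integral {e..d} (\<lambda>x. cis (\<theta> x)))"
    if "a \<le> c" "c \<le> e" "e \<le> d" "d \<le> b" for c d e
  proof -
    have "{c..d} \<subseteq> {a..b}" using that by auto
    from Henstock_Kurzweil_Integration.integral_combine[OF that(2,3) ci[OF this]] show ?thesis
      by (metis norm_triangle_ineq)
  qed
  have right: "norm (integral {c..b} (\<lambda>x. cis (\<theta> x))) \<le> 5 * \<delta>" if "a \<le> c" "c \<le> b" "\<theta>' c \<ge> 0" for c
  proof (cases "b \<le> c + \<delta>")
    case True
    then show ?thesis using norm_integral_cis_le_length[OF that(2) cont] that \<delta> by auto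
  next
    case False
    have "sqrt L \<le> \<bar>\<theta>' x\<bar>" if "x \<in> {c + \<delta>..b}" for x
    proof -
      have "L * \<delta> \<le> L * (x - c)" using that L by (intro mult_left_mono) auto
      then show ?thesis using slope[of c x] that \<open>a \<le> c\<close> \<open>\<theta>' c \<ge> 0\<close> L\<delta> \<delta>(1) by auto
    qed
    then have "norm (integral {c + \<delta>..b} (\<lambda>x. cis (\<theta> x))) \<le> 4 * \<delta>"
      using False that \<delta> by (intro near) auto
    moreover have "norm (integral {c..c+\<delta>} (\<lambda>x. cis (\<theta> x))) \<le> \<delta>"
      using norm_integral_cis_le_length[OF _ cont, of c "c + \<delta>"] that False \<delta> by auto
    ultimately show ?thesis using split[of c "c + \<delta>" b] that False \<delta> by auto
  qed
  have left: "norm (integral {a..c} (\<lambda>x. cis (\<theta> x))) \<le> 5 * \<delta>" if "a \<le> c" "c \<le> b" "\<theta>' c \<le> 0" for c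
  proof (cases "c \<le> a + \<delta>")
    case True
    then show ?thesis using norm_integral_cis_le_length[OF that(1) cont] that \<delta> by auto
  next
    case False
    have "sqrt L \<le> \<bar>\<theta>' x\<bar>" if "x \<in> {a..c - \<delta>}" for x
    proof -
      have "L * \<delta> \<le> L * (c - x)" using that L by (intro mult_left_mono) auto
      then show ?thesis using slope[of x c] that \<open>c \<le> b\<close> \<open>\<theta>' c \<le> 0\<close> L\<delta> \<delta>(1) by auto
    qed
    then have "norm (integral {a..c - \<delta>} (\<lambda>x. cis (\<theta> x))) \<le> 4 * \<delta>"
      using False that \<delta> by (intro near) auto
    moreover have "norm (integral {c-\<delta>..c} (\<lambda>x. cis (\<theta> x))) \<le> \<delta>"
      using norm_integral_cis_le_length[OF _ cont, of "c - \<delta>" c] that False \<delta> by auto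
    ultimately show ?thesis using split[of a "c - \<delta>" c] that False \<delta> by auto
  qed
  \<comment> \<open>Without a sign change, an endpoint takes the place of the zero and a one-sided
    estimate is enough.\<close>
  consider "\<theta>' a \<ge> 0" | "\<theta>' b \<le> 0" | "\<theta>' a < 0" "\<theta>' b > 0" by linarith
  then show ?thesis
  proof cases
    case 1
    then show ?thesis using right[of a] ab \<delta> by auto
  next
    case 2
    then show ?thesis using left[of b] ab \<delta> by auto
  next
    case 3
    have "continuous_on {a..b} \<theta>'"
      using d2 by (meson DERIV_continuous_on has_field_derivative_at_within)
    then obtain c where "a \<le> c" "c \<le> b" "\<theta>' c = 0"
      using IVT'[of \<theta>' a 0 b] 3 ab by auto
    then show ?thesis using left[of c] right[of c] split[of a c b] \<delta>(3) by auto
  qed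
qed

subsection \<open>The second derivative of the phase\<close>

definition phase :: "real \<Rightarrow> real" where "phase x = sqrt (x * tanh x)"

definition phase' :: "real \<Rightarrow> real" where
  "phase' x = (tanh x + x * (1 - (tanh x)\<^sup>2)) / (2 * sqrt (x * tanh x))"

text \<open>The numerator is grouped into two nonnegative terms because each one alone yields one of
  the lower bounds: the second term at low frequency, the first at high frequency.\<close>

definition phase'' :: "real \<Rightarrow> real" where
  "phase'' x = - ((tanh x - x * (1 - (tanh x)\<^sup>2))\<^sup>2 + 4 * x\<^sup>2 * (tanh x)\<^sup>2 * (1 - (tanh x)\<^sup>2))
     / (4 * (x * tanh x) * sqrt (x * tanh x))"

lemma DERIV_tanh: "(tanh has_real_derivative 1 - (tanh x)\<^sup>2) (at x)"
  by (rule has_field_derivative_tanh[OF _ DERIV_ident, THEN DERIV_cong]) auto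

lemma DERIV_x_tanh: "((\<lambda>x. x * tanh x) has_real_derivative tanh x + x * (1 - (tanh x)\<^sup>2)) (at x)"
  using DERIV_mult[OF DERIV_ident DERIV_tanh, of x] by (simp add: mult.commute)

lemma DERIV_phase:
  assumes "x > 0"
  shows "(phase has_real_derivative phase' x) (at x)"
proof -
  have "x * tanh x > 0" using assms by simp
  from DERIV_chain2[OF DERIV_real_sqrt[OF this] DERIV_x_tanh]
  show ?thesis unfolding phase_def[abs_def] phase'_def
    by (rule DERIV_cong) (simp add: field_simps)
qed

lemma DERIV_phase':
  assumes "x > 0"
  shows "(phase' has_real_derivative phase'' x) (at x)"
proof -
  define T where "T = tanh x"
  define r where "r = sqrt (x * T)"
  have pos: "x * tanh x > 0" using assms by simp
  have T: "T > 0" unfolding T_def using assms by simp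
  have r: "r > 0" "r * r = x * T" using pos by (auto simp: r_def T_def)
  have d1: "((\<lambda>x. tanh x + x * (1 - (tanh x)\<^sup>2)) has_real_derivative
      2 * (1 - T\<^sup>2) - 2 * x * T * (1 - T\<^sup>2)) (at x)"
    unfolding T_def
    by (auto intro!: derivative_eq_intros DERIV_tanh simp: algebra_simps power2_eq_square)
  have d2: "((\<lambda>x. 2 * sqrt (x * tanh x)) has_real_derivative (T + x * (1 - T\<^sup>2)) / r) (at x)"
    using DERIV_cmult[OF DERIV_chain2[OF DERIV_real_sqrt[OF pos] DERIV_x_tanh], of 2]
    unfolding T_def r_def by (rule DERIV_cong) (use pos in \<open>simp add: divide_simps\<close>)
  have "((\<lambda>x. (tanh x + x * (1 - (tanh x)\<^sup>2)) / (2 * sqrt (x * tanh x))) has_real_derivative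
     ((2 * (1 - T\<^sup>2) - 2 * x * T * (1 - T\<^sup>2)) * (2 * r) - (T + x * (1 - T\<^sup>2)) * ((T + x * (1 - T\<^sup>2)) / r))
       / (2 * r * (2 * r))) (at x)"
    using DERIV_divide[OF d1 d2] r(1) unfolding T_def[symmetric] r_def[symmetric] by simp
  moreover have "((2 * (1 - T\<^sup>2) - 2 * x * T * (1 - T\<^sup>2)) * (2 * r) - (T + x * (1 - T\<^sup>2)) * ((T + x * (1 - T\<^sup>2)) / r))
       / (2 * r * (2 * r)) = phase'' x"
  proof -
    have "phase'' x = - ((T - x * (1 - T\<^sup>2))\<^sup>2 + 4 * x\<^sup>2 * T\<^sup>2 * (1 - T\<^sup>2)) / (4 * (r * r) * r)"
      unfolding phase''_def by (simp add: T_def r(2)[unfolded T_def] flip: r_def[unfolded T_def])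
    \<comment> \<open>With S = 1 - T^2, the term 4xTS converts -(T + xS)^2 into -(T - xS)^2, which
      reveals the sign.\<close>
    moreover have "(2 * (1 - T\<^sup>2) - 2 * x * T * (1 - T\<^sup>2)) * (2 * (r * r)) - (T + x * (1 - T\<^sup>2))\<^sup>2
       = - ((T - x * (1 - T\<^sup>2))\<^sup>2 + 4 * x\<^sup>2 * T\<^sup>2 * (1 - T\<^sup>2))"
      unfolding r(2) by algebra
    moreover have "((2 * (1 - T\<^sup>2) - 2 * x * T * (1 - T\<^sup>2)) * (2 * r) - (T + x * (1 - T\<^sup>2)) * ((T + x * (1 - T\<^sup>2)) / r))
       / (2 * r * (2 * r)) = ((2 * (1 - T\<^sup>2) - 2 * x * T * (1 - T\<^sup>2)) * (2 * (r * r)) - (T + x * (1 - T\<^sup>2))\<^sup>2) / (4 * (r * r) * r)"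
      using r(1) by (simp add: divide_simps) (simp add: power2_eq_square algebra_simps)
    ultimately show ?thesis by simp
  qed
  ultimately show ?thesis unfolding phase'_def[abs_def] by simp
qed

text \<open>The derivative is 2 x tanh x (1 - tanh^2 x). Comparing with the value 0 at x = 0 gives
  tanh x > x (1 - tanh^2 x) for positive x; comparing with the value at 1 gives a uniform positive
  lower bound on [1, infinity).\<close>

lemma tanh_minus_deriv_strict_mono:
  fixes x y :: real
  assumes "0 \<le> x" "x < y"
  shows "tanh x - x * (1 - (tanh x)\<^sup>2) < tanh y - y * (1 - (tanh y)\<^sup>2)"
proof (rule DERIV_pos_imp_increasing_open[OF assms(2)])
  fix z assume z: "x < z" "z < y"
  have "((\<lambda>x. tanh x - x * (1 - (tanh x)\<^sup>2)) has_real_derivative 2 * z * tanh z * (1 - (tanh z)\<^sup>2)) (at z)"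
    by (auto intro!: derivative_eq_intros DERIV_tanh simp: algebra_simps power2_eq_square)
  moreover have "2 * z * tanh z * (1 - (tanh z)\<^sup>2) > 0"
    using z assms tanh_real_bounds[of z] by (intro mult_pos_pos) (auto simp: abs_square_less_1)
  ultimately show "\<exists>D. ((\<lambda>x. tanh x - x * (1 - (tanh x)\<^sup>2)) has_real_derivative D) (at z) \<and> 0 < D"
    by blast
qed (intro continuous_intros, simp_all)

text \<open>With r = sqrt (x T), the second numerator term is at least 4 s r^4, where s is the value
  of 1 - T^2 at x = 1. Division by 4 r^3 leaves s r, and r is at least s x because T is at least s x
  and s is at most 1. Hence the constant s^2.\<close>

lemma phase''_le_low_frequency:
  obtains c where "c > 0" "\<And>x. 0 < x \<Longrightarrow> x \<le> 1 \<Longrightarrow> phase'' x \<le> - (c * x)"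
proof
  define s where "s = 1 - (tanh (1::real))\<^sup>2"
  have s: "0 < s" "s \<le> 1" using tanh_real_bounds[of 1] by (auto simp: s_def abs_square_less_1)
  show "s * s > 0" using s by simp
  fix x :: real assume x: "0 < x" "x \<le> 1"
  define T where "T = tanh x"
  have T: "0 < T" "T \<le> tanh 1" using x by (auto simp: T_def)
  have S: "s \<le> 1 - T\<^sup>2" unfolding s_def using T by (intro diff_left_mono power_mono) auto
  have sx: "s * x \<le> T"
  proof -
    have "x * s \<le> x * (1 - T\<^sup>2)" using S x by (intro mult_left_mono) auto
    also have "\<dots> \<le> T" using tanh_minus_deriv_strict_mono[of 0 x] x by (simp add: T_def)
    finally show ?thesis by (simp add: mult.commute)
  qed
  define r where "r = sqrt (x * T)"
  have r: "r > 0" "r * r = x * T" using x T by (auto simp: r_def)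
  have "(s * x)\<^sup>2 \<le> (s * x) * x" 
    using s x by (simp add: power2_eq_square mult_left_le_one_le mult_left_mono)
  also have "\<dots> \<le> T * x" using sx x by (intro mult_right_mono) auto
  finally have "s * x \<le> r" unfolding r_def by (intro real_le_rsqrt) (simp add: mult.commute)
  then have "(s * s * x) * (4 * (r * r) * r) \<le> (s * r) * (4 * (r * r) * r)"
    using s r(1) by (intro mult_right_mono) (auto simp: mult.assoc)
  also have "\<dots> = 4 * (r * r) * (r * r) * s" by simp
  also have "\<dots> = 4 * x\<^sup>2 * T\<^sup>2 * s" unfolding r(2) by (simp add: power2_eq_square)
  also have "\<dots> \<le> 4 * x\<^sup>2 * T\<^sup>2 * (1 - T\<^sup>2)" using S by (intro mult_left_mono) auto
  also have "\<dots> \<le> (T - x * (1 - T\<^sup>2))\<^sup>2 + 4 * x\<^sup>2 * T\<^sup>2 * (1 - T\<^sup>2)" by simp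
  finally have "s * s * x \<le> ((T - x * (1 - T\<^sup>2))\<^sup>2 + 4 * x\<^sup>2 * T\<^sup>2 * (1 - T\<^sup>2)) / (4 * (r * r) * r)"
    using r(1) by (simp add: pos_le_divide_eq)
  also have "\<dots> = - phase'' x"
    unfolding phase''_def minus_divide_left[symmetric] minus_minus T_def r_def
    using r(2) by (simp add: T_def r_def)
  finally show "phase'' x \<le> - (s * s * x)" by simp
qed

text \<open>The first numerator term is at least d^2, where d > 0 is the value of T - x (1 - T^2) at
  x = 1, and the denominator is at most 4 x^(3/2) because T < 1. Hence the constant d^2 / 4.\<close>

lemma phase''_le_high_frequency:
  obtains c where "c > 0" "\<And>x. 1 \<le> x \<Longrightarrow> phase'' x \<le> - (c * x powr (-3/2))"
proof
  define d where "d = tanh (1::real) - (1 - (tanh (1::real))\<^sup>2)"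
  have "d > 0"
    using tanh_minus_deriv_strict_mono[of 0 1] by (simp add: d_def)
  then show "d\<^sup>2 / 4 > 0" by simp
  fix x :: real assume x: "1 \<le> x"
  define T where "T = tanh x"
  have T: "0 < T" "T < 1" using x tanh_real_bounds[of x] by (auto simp: T_def)
  define r where "r = sqrt (x * T)"
  have r: "r > 0" "r * r = x * T" using x T by (auto simp: r_def)
  have "r * r * r \<le> x powr (3/2)"
  proof -
    have "r * r * r = (x * T) powr (3/2)"
    proof -
      have "(x * T) powr (3/2) = (x * T) powr (1 + 1/2)" by simp
      also have "\<dots> = (x * T) * sqrt (x * T)" unfolding powr_add using x T by (simp add: powr_half_sqrt)
      finally show ?thesis using x T by (simp add: r_def)
    qed
    also have "\<dots> \<le> x powr (3/2)" using x T by (intro powr_mono2) auto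
    finally show ?thesis .
  qed
  have "d \<le> T - x * (1 - T\<^sup>2)" using tanh_minus_deriv_strict_mono[of 1 x] x
    by (cases "x = 1") (auto simp: T_def d_def)
  then have "d\<^sup>2 \<le> (T - x * (1 - T\<^sup>2))\<^sup>2" using \<open>d > 0\<close> by (intro power_mono) auto
  also have "\<dots> \<le> (T - x * (1 - T\<^sup>2))\<^sup>2 + 4 * x\<^sup>2 * T\<^sup>2 * (1 - T\<^sup>2)"
    using T by (simp add: abs_square_le_1)
  finally have N: "d\<^sup>2 \<le> (T - x * (1 - T\<^sup>2))\<^sup>2 + 4 * x\<^sup>2 * T\<^sup>2 * (1 - T\<^sup>2)" .
  have "d\<^sup>2 / 4 * x powr (-3/2) = d\<^sup>2 / (4 * x powr (3/2))"
    using x by (simp add: powr_minus divide_simps)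
  also have "\<dots> \<le> ((T - x * (1 - T\<^sup>2))\<^sup>2 + 4 * x\<^sup>2 * T\<^sup>2 * (1 - T\<^sup>2)) / (4 * (r * r) * r)"
    using N \<open>r * r * r \<le> _\<close> r(1) order_trans[OF zero_le_power2 N] by (intro frac_le) auto
  also have "\<dots> = - phase'' x"
    unfolding phase''_def minus_divide_left[symmetric] minus_minus T_def r_def
    using r(2) by (simp add: T_def r_def)
  finally show "phase'' x \<le> - (d\<^sup>2 / 4 * x powr (-3/2))" by simp
qed

subsection \<open>Integration by parts\<close>

lemma lebesgue_integrable_reflect:
  fixes f :: "real \<Rightarrow> 'a::{banach, second_countable_topology}"
  assumes "integrable lebesgue f"
  shows "integrable lebesgue (\<lambda>x. f (- x))" "(LINT x|lebesgue. f (- x)) = (LINT x|lebesgue. f x)"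
proof -
  have m: "(\<lambda>x::real. -1 * x) \<in> lebesgue \<rightarrow>\<^sub>M lebesgue"
  proof -
    have "(*\<^sub>R) (- 1) = (\<lambda>x::real. -1 * x)" by (simp add: fun_eq_iff)
    then show ?thesis using lebesgue_measurable_scaling[of "-1", where 'a = real] by metis
  qed
  have eq: "distr lebesgue lebesgue (\<lambda>x::real. -1 * x) = lebesgue"
    using lebesgue_real_scale[of "-1"] by (simp add: density_1)
  have f: "f \<in> borel_measurable lebesgue" using assms by (rule borel_measurable_integrable)
  show "integrable lebesgue (\<lambda>x. f (- x))"
    using integrable_distr_eq[OF m, of f] assms f unfolding eq by simp
  show "(LINT x|lebesgue. f (- x)) = (LINT x|lebesgue. f x)"
    using integral_distr[OF m, of f] f unfolding eq by simp
qed

text \<open>Replaces "zero derivative implies constant" for functions that may fail to be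
  differentiable at many points: the increments are of second order, one factor being the length and
  the other the increment of \<open>v\<close>, whose sum telescopes.\<close>

lemma telescoping_increments_eq:
  fixes D :: "real \<Rightarrow> 'a::real_normed_vector" and v :: "real \<Rightarrow> real"
  assumes ab: "a \<le> b"
    and inc: "\<And>x y. a \<le> x \<Longrightarrow> x \<le> y \<Longrightarrow> y \<le> b \<Longrightarrow> norm (D y - D x) \<le> K * (y - x) * (v y - v x)"
  shows "D b = D a"
proof -
  \<comment> \<open>Sum the hypothesis over a partition of $[a,b]$ into $n + 1$ equal pieces.\<close>
  have bound: "norm (D b - D a) \<le> K * (b - a) * (v b - v a) / Suc n" for n
  proof -
    define p where "p i = a + real i * ((b - a) / Suc n)" for i
    have p0: "p 0 = a" "p (Suc n) = b" by (simp_all add: p_def)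
    have step: "p (Suc i) - p i = (b - a) / Suc n" for i
      by (simp add: p_def algebra_simps add_divide_distrib diff_divide_distrib)
    have pm: "p i \<le> p (Suc i)" for i using step[of i] ab by (smt (verit) divide_nonneg_nonneg of_nat_0_le_iff)
    then have mono: "p i \<le> p j" if "i \<le> j" for i j using lift_Suc_mono_le[of p] that by blast
    have "norm (D b - D a) = norm (\<Sum>i<Suc n. D (p (Suc i)) - D (p i))"
      using sum_lessThan_telescope[of "\<lambda>i. D (p i)" "Suc n"] by (simp only: p0)
    also have "\<dots> \<le> (\<Sum>i<Suc n. K * ((b - a) / Suc n) * (v (p (Suc i)) - v (p i)))"
    proof (rule sum_norm_le)
      fix i assume "i \<in> {..<Suc n}"
      then have "a \<le> p i" "p (Suc i) \<le> b" using mono[of 0 i] mono[of "Suc i" "Suc n"] p0 by auto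
      from inc[OF this(1) pm this(2)] show
        "norm (D (p (Suc i)) - D (p i)) \<le> K * ((b - a) / Suc n) * (v (p (Suc i)) - v (p i))"
        unfolding step .
    qed
    also have "\<dots> = K * ((b - a) / Suc n) * (v b - v a)"
      using sum_lessThan_telescope[of "\<lambda>i. v (p i)" "Suc n"] by (simp only: p0 flip: sum_distrib_left)
    finally show ?thesis by simp
  qed
  have "(\<lambda>n. K * (b - a) * (v b - v a) / Suc n) \<longlonglongrightarrow> 0"
    by (intro tendsto_divide_0[OF tendsto_const] filterlim_at_top_imp_at_infinity
        filterlim_compose[OF filterlim_real_sequentially filterlim_Suc])
  then have "norm (D b - D a) \<le> 0"
    by (rule tendsto_lowerbound) (use bound in auto)
  then show ?thesis by simp
qed

lemma integration_by_parts_absolutely_continuous: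
  fixes E G g dg :: "real \<Rightarrow> complex"
  assumes ab: "a \<le> b"
    and E: "continuous_on {a..b} E" 
    and G: "\<And>x y. a \<le> x \<Longrightarrow> x \<le> y \<Longrightarrow> y \<le> b \<Longrightarrow> (E has_integral (G y - G x)) {x..y}"
    and dg: "dg absolutely_integrable_on {a..b}"
    and g: "\<And>x y. a \<le> x \<Longrightarrow> x \<le> y \<Longrightarrow> y \<le> b \<Longrightarrow> (dg has_integral (g y - g x)) {x..y}"
  shows "(\<lambda>x. G x * dg x) absolutely_integrable_on {a..b}"
    "integral {a..b} (\<lambda>x. E x * g x) = G b * g b - G a * g a - integral {a..b} (\<lambda>x. G x * dg x)"
proof -
  have cont_ind: "continuous_on {a..b} u"
    if u: "\<And>x y. a \<le> x \<Longrightarrow> x \<le> y \<Longrightarrow> y \<le> b \<Longrightarrow> (du has_integral (u y - u x)) {x..y}" for u du :: "real \<Rightarrow> complex"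
  proof -
    have "continuous_on {a..b} (\<lambda>x. u a + integral {a..x} du)"
      by (intro continuous_intros indefinite_integral_continuous_1 has_integral_integrable[OF u[of a b]]) (use ab in auto)
    moreover have "u a + integral {a..x} du = u x" if "x \<in> {a..b}" for x
      using integral_unique[OF u[of a x]] that by auto
    ultimately show ?thesis by (metis (no_types, lifting) continuous_on_cong)
  qed
  have Gc: "continuous_on {a..b} G" by (rule cont_ind[OF G])
  have gc: "continuous_on {a..b} g" by (rule cont_ind[OF g])
  show Gdg: "(\<lambda>x. G x * dg x) absolutely_integrable_on {a..b}"
    by (rule absolutely_integrable_bounded_measurable_product[OF _ _ _ _ dg])
      (use Gc in \<open>auto intro!: bilinear_times compact_imp_bounded compact_continuous_image
         continuous_imp_measurable_on_sets_lebesgue\<close>)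
  have Eg: "(\<lambda>x. E x * g x) absolutely_integrable_on {a..b}"
    by (intro absolutely_integrable_continuous_real continuous_on_mult E gc)
  have ndg: "(\<lambda>x. norm (dg x)) integrable_on {a..b}" using dg absolutely_integrable_on_def by blast
  have int: "(\<lambda>x. G x * dg x) integrable_on {x..y}" "(\<lambda>x. E x * g x) integrable_on {x..y}"
     "(\<lambda>x. norm (dg x)) integrable_on {x..y}"
    if "a \<le> x" "y \<le> b" for x y
    using set_lebesgue_integral_eq_integral(1)[OF Gdg] set_lebesgue_integral_eq_integral(1)[OF Eg] ndg that
    by (auto intro: integrable_on_subinterval)
  have "compact (E ` {a..b})" by (rule compact_continuous_image[OF E]) simp
  then have "bounded (E ` {a..b})" by (rule compact_imp_bounded)
  then obtain S where S: "\<And>x. x \<in> {a..b} \<Longrightarrow> norm (E x) \<le> S" unfolding bounded_iff ball_simps(9) by metis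
  have S0: "0 \<le> S" using S[of a] ab order_trans[OF norm_ge_zero] by auto
  \<comment> \<open>\<open>v\<close> controls the oscillation of \<open>g\<close>: over [x, y],
    \<open>g\<close> varies by at most \<open>v y - v x\<close>. \<open>D\<close> is the defect of
    the formula on [a, x], up to the constant \<open>G a * g a\<close>.\<close>
  define v where "v x = integral {a..x} (\<lambda>s. norm (dg s))" for x
  define D where "D x = G x * g x - integral {a..x} (\<lambda>s. G s * dg s) - integral {a..x} (\<lambda>s. E s * g s)" for x
  have "D b = D a"
  proof (rule telescoping_increments_eq[OF ab, where K = "2 * S" and v = v])
    fix x y assume xy: "a \<le> x" "x \<le> y" "y \<le> b"
    have comb: "integral {a..y} u - integral {a..x} u = integral {x..y} u"
      if "u integrable_on {a..y}" for u :: "real \<Rightarrow> 'b::banach"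
      using Henstock_Kurzweil_Integration.integral_combine[OF xy(1,2) that] by (simp add: algebra_simps)
    have sub: "{x..y} \<subseteq> {a..b}" using xy by auto
    have GL: "norm (G s - G x) \<le> S * (y - x)" if "s \<in> {x..y}" for s
    proof -
      have "norm (G s - G x) \<le> S * (s - x)"
        using has_integral_bound_real[OF S0 finite.emptyI G[of x s]] S that xy by auto
      also have "\<dots> \<le> S * (y - x)" using that S0 by (intro mult_left_mono) auto
      finally show ?thesis .
    qed
    have vxy: "v y - v x = integral {x..y} (\<lambda>s. norm (dg s))"
      unfolding v_def using xy by (intro comb int) auto
    have v0: "0 \<le> v y - v x" unfolding vxy by (intro integral_nonneg int) (use xy in auto)
    have gL: "norm (g y - g s) \<le> v y - v x" if "s \<in> {x..y}" for s
    proof -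
      have "norm (g y - g s) = norm (integral {s..y} dg)"
        using integral_unique[OF g[of s y]] that xy by simp
      also have "\<dots> \<le> integral {s..y} (\<lambda>s. norm (dg s))"
        by (rule integral_norm_bound_integral[OF has_integral_integrable[OF g]]) (use that xy in \<open>auto intro: int\<close>)
      also have "\<dots> \<le> integral {x..y} (\<lambda>s. norm (dg s))"
        by (rule integral_subset_le) (use that xy in \<open>auto intro: int\<close>)
      finally show ?thesis unfolding vxy .
    qed
    have dgi: "dg integrable_on {x..y}" using g[of x y] xy by blast
    have Ei: "E integrable_on {x..y}" using G[of x y] xy by blast
    have i1: "integral {x..y} (\<lambda>s. (G s - G x) * dg s) = integral {x..y} (\<lambda>s. G s * dg s) - G x * (g y - g x)"
      using integral_unique[OF g[of x y]] xy dgi int[of x y]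
      by (simp add: left_diff_distrib Henstock_Kurzweil_Integration.integral_diff integrable_on_mult_right)
    have i2: "integral {x..y} (\<lambda>s. E s * (g y - g s)) = (G y - G x) * g y - integral {x..y} (\<lambda>s. E s * g s)"
      using integral_unique[OF G[of x y]] xy Ei int[of x y]
      by (simp add: right_diff_distrib Henstock_Kurzweil_Integration.integral_diff integrable_on_mult_left)
    \<comment> \<open>The factors \<open>g\<close> and \<open>G\<close> are compared with their
      values at opposite ends, \<open>g y\<close> and \<open>G x\<close>, so that the boundary
      products cancel and each integral contains one small length and one small variation.\<close>
    have "D y - D x = integral {x..y} (\<lambda>s. E s * (g y - g s)) - integral {x..y} (\<lambda>s. (G s - G x) * dg s)"
    proof -
      have "D y - D x = G y * g y - G x * g x - integral {x..y} (\<lambda>s. G s * dg s) - integral {x..y} (\<lambda>s. E s * g s)"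
        unfolding D_def using comb[OF int(1)[OF order_refl xy(3)]] comb[OF int(2)[OF order_refl xy(3)]]
        by (simp add: algebra_simps)
      then show ?thesis unfolding i1 i2 by (simp add: algebra_simps)
    qed
    also have "norm \<dots> \<le> S * (v y - v x) * (y - x) + S * (y - x) * (v y - v x)"
    proof (rule order_trans[OF norm_triangle_ineq4 add_mono])
      show "norm (integral {x..y} (\<lambda>s. E s * (g y - g s))) \<le> S * (v y - v x) * (y - x)"
      proof (rule integral_bound)
        show "continuous_on {x..y} (\<lambda>s. E s * (g y - g s))"
          by (intro continuous_intros continuous_on_subset[OF E sub] continuous_on_subset[OF gc sub])
        show "norm (E s * (g y - g s)) \<le> S * (v y - v x)" if "s \<in> {x..y}" for s
          unfolding norm_mult using S[of s] gL[OF that] sub that S0 by (intro mult_mono) auto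
      qed (rule xy)
      have "norm (integral {x..y} (\<lambda>s. (G s - G x) * dg s)) \<le> integral {x..y} (\<lambda>s. S * (y - x) * norm (dg s))"
      proof (rule integral_norm_bound_integral)
        show "(\<lambda>s. (G s - G x) * dg s) integrable_on {x..y}"
          unfolding left_diff_distrib
          by (intro integrable_diff int integrable_on_mult_right dgi xy)
        show "(\<lambda>s. S * (y - x) * norm (dg s)) integrable_on {x..y}"
          by (intro integrable_on_mult_right int xy)
        show "norm ((G s - G x) * dg s) \<le> S * (y - x) * norm (dg s)" if "s \<in> {x..y}" for s
          unfolding norm_mult by (intro mult_right_mono GL that) simp
      qed
      then show "norm (integral {x..y} (\<lambda>s. (G s - G x) * dg s)) \<le> S * (y - x) * (v y - v x)"
        unfolding vxy by simp
    qed
    finally show "norm (D y - D x) \<le> 2 * S * (y - x) * (v y - v x)" by (simp add: algebra_simps)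
  qed
  then show "integral {a..b} (\<lambda>x. E x * g x) = G b * g b - G a * g a - integral {a..b} (\<lambda>x. G x * dg x)"
    by (simp add: D_def algebra_simps)
qed

text \<open>Even in \<open>x\<close>, so that it serves both half lines. At 0 its value is 0, by
  division by zero, rather than a singularity; positivity and continuity are therefore stated for
  positive \<open>x\<close>.\<close>

definition dispersive_weight :: "real \<Rightarrow> real \<Rightarrow> real" where
  "dispersive_weight \<mu> x = 1 / sqrt \<mu> * (1 / sqrt \<bar>x\<bar>) + \<mu> powr (1/8) * \<bar>x\<bar> powr (3/4)"

text \<open>Represents the phase of the oscillatory integral only for nonnegative \<open>x\<close>:
  \<open>phase\<close> is even, whereas the dispersion relation is odd.\<close>

definition dispersive_phase :: "real \<Rightarrow> real \<Rightarrow> real \<Rightarrow> real \<Rightarrow> real" where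
  "dispersive_phase \<mu> t X x = X * x - t * (phase (sqrt \<mu> * x) / sqrt \<mu>)"

lemma continuous_on_phase: "continuous_on S phase"
  unfolding phase_def[abs_def] by (intro continuous_intros) auto

lemma continuous_on_dispersive_phase: "continuous_on S (dispersive_phase \<mu> t X)"
  unfolding dispersive_phase_def[abs_def] divide_inverse
  by (intro continuous_intros continuous_on_compose2[OF continuous_on_phase[of UNIV]]) auto

subsection \<open>The primitive of the oscillating factor\<close>

text \<open>Two derivatives remove the linear term, which is why the bound is uniform in
  \<open>X\<close>, and rescaling leaves a factor \<open>t * sqrt \<mu>\<close>. The interval stays
  away from 0, near which \<open>phase\<close> behaves like the absolute value.\<close>

lemma norm_integral_dispersive_phase_le:
  assumes "\<mu> > 0" "t > 0" "0 < a" "a \<le> b" "L > 0"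
    "\<And>x. x \<in> {a..b} \<Longrightarrow> phase'' (sqrt \<mu> * x) \<le> - L"
  shows "norm (integral {a..b} (\<lambda>x. cis (dispersive_phase \<mu> t X x))) \<le> 10 / sqrt (t * sqrt \<mu> * L)"
proof (rule van_der_Corput_second_derivative[OF \<open>a \<le> b\<close>])
  fix x assume x: "x \<in> {a..b}"
  have k: "sqrt \<mu> > 0" "sqrt \<mu> * x > 0" using assms x by auto
  have lin: "((\<lambda>x. sqrt \<mu> * x) has_real_derivative sqrt \<mu>) (at x)"
    using DERIV_cmult_Id .
  have d0: "((\<lambda>x. phase (sqrt \<mu> * x)) has_real_derivative phase' (sqrt \<mu> * x) * sqrt \<mu>) (at x)"
    by (rule DERIV_chain2[OF DERIV_phase[OF k(2)] lin])
  have d1: "((\<lambda>x. phase' (sqrt \<mu> * x)) has_real_derivative phase'' (sqrt \<mu> * x) * sqrt \<mu>) (at x)"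
    by (rule DERIV_chain2[OF DERIV_phase'[OF k(2)] lin])
  show "(dispersive_phase \<mu> t X has_real_derivative X - t * phase' (sqrt \<mu> * x)) (at x)"
    unfolding dispersive_phase_def[abs_def]
    using DERIV_diff[OF DERIV_cmult_Id[of X] DERIV_cmult[OF DERIV_cdivide[OF d0, of "sqrt \<mu>"], of t]] k(1)
    by simp
  show "((\<lambda>x. X - t * phase' (sqrt \<mu> * x)) has_real_derivative - (t * (phase'' (sqrt \<mu> * x) * sqrt \<mu>))) (at x)"
    using DERIV_diff[OF DERIV_const[of X] DERIV_cmult[OF d1, of t]] by simp
  have "t * sqrt \<mu> * phase'' (sqrt \<mu> * x) \<le> t * sqrt \<mu> * (- L)"
    using assms(6)[OF x] assms(2) k by (intro mult_left_mono) auto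
  then show "t * sqrt \<mu> * L \<le> - (t * (phase'' (sqrt \<mu> * x) * sqrt \<mu>))"
    by (simp add: mult_ac)
qed (use assms in simp)

text \<open>The base point is where \<open>sqrt \<mu> * x = 1\<close>, the crossover between the two
  estimates of \<open>phase''\<close>. On either side the lower bound weakens towards
  \<open>x\<close>, so its value at \<open>x\<close> holds on the whole interval and yields one of
  the two terms of the weight.\<close>

lemma dispersive_primitive_bound:
  obtains C where "C > 0"
    "\<And>\<mu> t X x. \<mu> > 0 \<Longrightarrow> t > 0 \<Longrightarrow> x > 0 \<Longrightarrow>
      norm (integral {0..x} (\<lambda>x. cis (dispersive_phase \<mu> t X x))
        - integral {0..1 / sqrt \<mu>} (\<lambda>x. cis (dispersive_phase \<mu> t X x)))
      \<le> C / sqrt t * dispersive_weight \<mu> x"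
proof -
  obtain c1 where c1: "c1 > 0" "\<And>x. 0 < x \<Longrightarrow> x \<le> 1 \<Longrightarrow> phase'' x \<le> - (c1 * x)"
    using phase''_le_low_frequency by blast
  obtain c2 where c2: "c2 > 0" "\<And>x. 1 \<le> x \<Longrightarrow> phase'' x \<le> - (c2 * x powr (-3/2))"
    using phase''_le_high_frequency by blast
  define C where "C = 10 / sqrt c1 + 10 / sqrt c2"
  have C: "C > 0" "10 / sqrt c1 \<le> C" "10 / sqrt c2 \<le> C" using c1(1) c2(1) by (simp_all add: C_def add_pos_pos)
  have "norm (integral {0..x} (\<lambda>x. cis (dispersive_phase \<mu> t X x))
        - integral {0..1 / sqrt \<mu>} (\<lambda>x. cis (dispersive_phase \<mu> t X x)))
      \<le> C / sqrt t * dispersive_weight \<mu> x"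
    if \<mu>: "\<mu> > 0" and t: "t > 0" and x: "x > 0" for \<mu> t X x
  proof -
    define E where "E = (\<lambda>x. cis (dispersive_phase \<mu> t X x))"
    define k where "k = sqrt \<mu>"
    have k: "k > 0" "k * k = \<mu>" using \<mu> by (simp_all add: k_def)
    have Ei: "E integrable_on {a..b}" for a b
      unfolding E_def by (intro integrable_continuous_real continuous_on_cis continuous_on_dispersive_phase)
    have w: "0 \<le> 1 / k * (1 / sqrt x)" "0 \<le> \<mu> powr (1/8) * x powr (3/4)" using k x by auto
    have dw: "dispersive_weight \<mu> x = 1 / k * (1 / sqrt x) + \<mu> powr (1/8) * x powr (3/4)"
      using x by (simp add: dispersive_weight_def k_def)
    show ?thesis
    proof (cases "x \<le> 1 / k")
      case True
      have "norm (integral {x..1/k} E) \<le> 10 / sqrt (t * sqrt \<mu> * (c1 * (k * x)))"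
        unfolding E_def
      proof (rule norm_integral_dispersive_phase_le[OF \<mu> t x True])
        fix y assume y: "y \<in> {x..1/k}"
        then have "k * x \<le> k * y" "0 < k * y" "k * y \<le> 1" using x k by (auto simp: field_simps)
        moreover from this have "c1 * (k * x) \<le> c1 * (k * y)" using c1(1) mult_left_mono[of "k * x" "k * y" c1] by simp
        ultimately show "phase'' (sqrt \<mu> * y) \<le> - (c1 * (k * x))"
          using c1(2)[of "k * y"] by (simp add: k_def)
      qed (use k c1 x in simp)
      also have "t * sqrt \<mu> * (c1 * (k * x)) = t * c1 * k\<^sup>2 * x"
        by (simp add: k_def[symmetric] power2_eq_square)
      also have "10 / sqrt (t * c1 * k\<^sup>2 * x) = 10 / sqrt c1 / sqrt t * (1 / k * (1 / sqrt x))"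
        using k by (simp add: real_sqrt_mult)
      also have "\<dots> \<le> C / sqrt t * dispersive_weight \<mu> x"
        using C w t c1(1) unfolding dw by (intro mult_mono divide_right_mono) auto
      also have "integral {x..1/k} E = integral {0..1/k} E - integral {0..x} E"
        using Henstock_Kurzweil_Integration.integral_combine[OF _ True Ei[of 0 "1/k"]] x
        by (simp add: algebra_simps)
      finally show ?thesis unfolding E_def[symmetric] k_def[symmetric] by (simp add: norm_minus_commute)
    next
      case False
      then have x1: "1 / k \<le> x" by simp
      have kx: "1 \<le> k * x" using x1 k by (simp add: field_simps)
      have "norm (integral {1/k..x} E) \<le> 10 / sqrt (t * sqrt \<mu> * (c2 * (k * x) powr (-3/2)))"
        unfolding E_def
      proof (rule norm_integral_dispersive_phase_le[OF \<mu> t _ x1])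
        fix y assume y: "y \<in> {1/k..x}"
        then have "k * y \<le> k * x" "1 \<le> k * y" using x k by (auto simp: field_simps)
        moreover from this have "(k * x) powr (-3/2) \<le> (k * y) powr (-3/2)"
          by (intro powr_mono2'; linarith)
        then have "c2 * (k * x) powr (-3/2) \<le> c2 * (k * y) powr (-3/2)"
          using c2(1) by simp
        ultimately show "phase'' (sqrt \<mu> * y) \<le> - (c2 * (k * x) powr (-3/2))"
          using c2(2)[of "k * y"] by (simp add: k_def)
      qed (use k c2 x in simp_all)
      \<comment> \<open>Exponent count: k (kx)^(-3/2) = k^(-1/2) x^(-3/2), whose square root is
        k^(-1/4) x^(-3/4), and k^(-1/4) = mu^(-1/8).\<close>
      also have "sqrt (t * sqrt \<mu> * (c2 * (k * x) powr (-3/2))) = sqrt t * sqrt c2 / (\<mu> powr (1/8) * x powr (3/4))"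
      proof -
        have "sqrt (t * sqrt \<mu> * (c2 * (k * x) powr (-3/2))) = sqrt t * sqrt c2 * sqrt (k * (k * x) powr (-3/2))"
          by (simp add: real_sqrt_mult k_def)
        also have "sqrt (k * (k * x) powr (-3/2)) = (k * (k * x) powr (-3/2)) powr (1/2)"
          using k by (simp add: powr_half_sqrt)
        also have "\<dots> = k powr (1/2) * (k * x) powr (-3/4)"
          using k x by (simp add: powr_mult powr_powr)
        also have "\<dots> = k powr (-1/4) * x powr (-3/4)"
          using k x by (simp add: powr_mult flip: powr_add mult.assoc)
        also have "k powr (-1/4) = \<mu> powr (-1/8)"
        proof -
          have "k = \<mu> powr (1/2)" using \<mu> by (simp add: k_def powr_half_sqrt)
          then have "k powr (-1/4) = \<mu> powr (1/2 * (-1/4))" by (simp only: powr_powr)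
          then show ?thesis by simp
        qed
        also have "\<mu> powr (-1/8) = 1 / \<mu> powr (1/8)" using powr_minus_divide[of \<mu> "1/8"] by simp
        also have "x powr (-3/4) = 1 / x powr (3/4)" using powr_minus_divide[of x "3/4"] by simp
        finally show ?thesis by simp
      qed
      also have "10 / (sqrt t * sqrt c2 / (\<mu> powr (1/8) * x powr (3/4))) = 10 / sqrt c2 / sqrt t * (\<mu> powr (1/8) * x powr (3/4))"
        by simp
      also have "\<dots> \<le> C / sqrt t * dispersive_weight \<mu> x"
        using C w t c2(1) unfolding dw by (intro mult_mono divide_right_mono) auto
      also have "integral {1/k..x} E = integral {0..x} E - integral {0..1/k} E"
        using Henstock_Kurzweil_Integration.integral_combine[OF _ x1 Ei[of 0 x]] k
        by (simp add: algebra_simps)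
      finally show ?thesis unfolding E_def[symmetric] k_def[symmetric] .
    qed
  qed
  with C(1) show thesis by (rule that)
qed

subsection \<open>Oscillatory integrals on the half line\<close>

text \<open>Any constant \<open>K\<close> is admissible since \<open>g\<close> vanishes at 0. The
  remaining integral of the primitive against \<open>dg\<close> is dominated by the weighted norm,
  so it converges even though \<open>E * g\<close> is not assumed integrable. Stated abstractly in
  order to be applied once per half line.\<close>

lemma half_line_oscillatory_integral:
  fixes E g dg :: "real \<Rightarrow> complex" and w :: "real \<Rightarrow> real"
  assumes E: "continuous_on UNIV E"
    and primitive: "\<And>x. x > 0 \<Longrightarrow> norm (integral {0..x} E - K) \<le> C * w x"
    and w: "continuous_on {0<..} w" "\<And>x. x > 0 \<Longrightarrow> w x > 0" "((\<lambda>x. w x / x) \<longlongrightarrow> 0) at_top"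
    and g: "\<And>x y. 0 \<le> x \<Longrightarrow> x \<le> y \<Longrightarrow> (dg has_integral (g y - g x)) {x..y}"
    and dg: "\<And>M. dg absolutely_integrable_on {0..M}"
    and g0: "g 0 = 0" and decay: "\<And>x. x > 0 \<Longrightarrow> x * norm (g x) \<le> B"
    and wdg: "integrable lebesgue (\<lambda>x. w x *\<^sub>R dg x)"
  obtains I where "((\<lambda>M. integral {0..M} (\<lambda>x. E x * g x)) \<longlongrightarrow> I) at_top"
    "norm I \<le> C * (LINT x|lebesgue. norm (w x *\<^sub>R dg x))"
proof -
  define G where "G x = integral {0..x} E - K" for x
  define P where "P x = indicat_real {0<..} x *\<^sub>R (G x * dg x)" for x
  have Ei: "E integrable_on {x..y}" for x y
    by (intro integrable_continuous_real continuous_on_subset[OF E]) simp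
  have GE: "(E has_integral (G y - G x)) {x..y}" if "0 \<le> x" "x \<le> y" for x y
  proof -
    have "G y - G x = integral {x..y} E"
      using Henstock_Kurzweil_Integration.integral_combine[OF that Ei] by (simp add: G_def algebra_simps)
    then show ?thesis using integrable_integral[OF Ei] by simp
  qed
  have parts: "(\<lambda>x. G x * dg x) absolutely_integrable_on {0..M}"
    "integral {0..M} (\<lambda>x. E x * g x) = G M * g M - integral {0..M} (\<lambda>x. G x * dg x)"
    if "0 \<le> M" for M
    using integration_by_parts_absolutely_continuous[OF that, of E G dg g] GE g dg g0 continuous_on_subset[OF E]
    by simp_all
  have Gc: "continuous_on {0<..} G"
  proof (rule continuous_at_imp_continuous_on, rule ballI)
    fix x :: real assume x: "x \<in> {0<..}"
    have "continuous_on {0..x+1} G"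
      unfolding G_def[abs_def] by (intro continuous_intros indefinite_integral_continuous_1 Ei)
    then have "continuous (at x within {0..x+1}) G"
      using x by (simp add: continuous_on_eq_continuous_within)
    then show "isCont G x" using x by (simp add: at_within_Icc_at)
  qed
  have Pb: "norm (P x) \<le> C * norm (w x *\<^sub>R dg x)" for x
  proof (cases "x > 0")
    case True
    then have "norm (G x) * norm (dg x) \<le> C * w x * norm (dg x)"
      using primitive[of x] by (intro mult_right_mono) (auto simp: G_def)
    then show ?thesis using True w(2)[of x] by (simp add: P_def norm_mult mult.assoc)
  next
    case False
    \<comment> \<open>The sign of \<open>C\<close> follows from the primitive bound itself, read at
      the point 1.\<close>
    have "0 \<le> C * w 1" using primitive[of 1] order_trans[OF norm_ge_zero] by simp
    then have "0 \<le> C" using w(2)[of 1] by (simp add: zero_le_mult_iff)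
    then show ?thesis using False by (simp add: P_def)
  qed
  have P: "integrable lebesgue P"
  proof (rule Bochner_Integration.integrable_bound)
    show "integrable lebesgue (\<lambda>x. C * norm (w x *\<^sub>R dg x))"
      using integrable_norm[OF wdg] by (rule integrable_mult_right)
    \<comment> \<open>Measurability is inherited from the weighted derivative: \<open>P\<close> is
      (G / w) times \<open>w * dg\<close>, and G / w is continuous on the open half line.\<close>
    have "(\<lambda>x. indicator {0<..} x *\<^sub>R (G x / of_real (w x))) \<in> borel_measurable lebesgue"
      by (intro measurable_completion, unfold measurable_lborel2)
        (intro borel_measurable_continuous_on_indicator continuous_intros Gc w(1); use w(2) in force)
    then have "(\<lambda>x. indicator {0<..} x *\<^sub>R (G x / of_real (w x)) * (w x *\<^sub>R dg x)) \<in> borel_measurable lebesgue"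
      by (intro borel_measurable_times borel_measurable_integrable[OF wdg])
    also have "(\<lambda>x. indicator {0<..} x *\<^sub>R (G x / of_real (w x)) * (w x *\<^sub>R dg x)) = P"
    proof
      fix x
      show "indicator {0<..} x *\<^sub>R (G x / of_real (w x)) * (w x *\<^sub>R dg x) = P x"
        using w(2)[of x] by (cases "x > 0") (simp_all add: P_def scaleR_conv_of_real)
    qed
    finally show "P \<in> borel_measurable lebesgue" .
    show "AE x in lebesgue. norm (P x) \<le> norm (C * norm (w x *\<^sub>R dg x))"
      by (intro AE_I2 order_trans[OF Pb]) simp
  qed
  have limP: "((\<lambda>M. LINT x|lebesgue. indicat_real {..M} x *\<^sub>R P x) \<longlongrightarrow> (LINT x|lebesgue. P x)) at_top"
  proof (rule integral_dominated_convergence_at_top)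
    show "integrable lebesgue (\<lambda>x. norm (P x))" using P by (rule integrable_norm)
    show "P \<in> borel_measurable lebesgue" using P by (rule borel_measurable_integrable)
    then show "(\<lambda>x. indicat_real {..M} x *\<^sub>R P x) \<in> borel_measurable lebesgue" for M
      by (intro borel_measurable_scaleR borel_measurable_indicator) auto
    show "AE x in lebesgue. ((\<lambda>M. indicat_real {..M} x *\<^sub>R P x) \<longlongrightarrow> P x) at_top"
    proof (rule AE_I2)
      fix x
      show "((\<lambda>M. indicat_real {..M} x *\<^sub>R P x) \<longlongrightarrow> P x) at_top"
        by (intro tendsto_eventually eventually_mono[OF eventually_ge_at_top[of x]]) simp
    qed
    show "\<forall>\<^sub>F M in at_top. AE x in lebesgue. norm (indicat_real {..M} x *\<^sub>R P x) \<le> norm (P x)"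
      by (intro always_eventually allI AE_I2) (simp add: indicator_def)
  qed
  have trunc: "(LINT x|lebesgue. indicat_real {..M} x *\<^sub>R P x) = integral {0..M} (\<lambda>x. G x * dg x)" if "0 \<le> M" for M
  proof -
    have nz: "AE x::real in lebesgue. x \<noteq> 0"
      by (rule AE_completion) (rule AE_lborel_singleton)
    have "(LINT x|lebesgue. indicat_real {..M} x *\<^sub>R P x) = (LINT x:{0..M}|lebesgue. G x * dg x)"
      unfolding set_lebesgue_integral_def
    proof (rule integral_cong_AE)
      show "(\<lambda>x. indicat_real {..M} x *\<^sub>R P x) \<in> borel_measurable lebesgue"
        by (intro borel_measurable_scaleR borel_measurable_indicator borel_measurable_integrable[OF P]) auto
      show "(\<lambda>x. indicat_real {0..M} x *\<^sub>R (G x * dg x)) \<in> borel_measurable lebesgue"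
        using parts(1)[OF that] unfolding set_integrable_def by (rule borel_measurable_integrable)
      show "AE x in lebesgue. indicat_real {..M} x *\<^sub>R P x = indicat_real {0..M} x *\<^sub>R (G x * dg x)"
        using nz by eventually_elim (auto simp: P_def indicator_def)
    qed
    then show ?thesis using set_lebesgue_integral_eq_integral(2)[OF parts(1)[OF that]] by simp
  qed
  have lim: "((\<lambda>M. integral {0..M} (\<lambda>x. G x * dg x)) \<longlongrightarrow> (LINT x|lebesgue. P x)) at_top"
    by (rule Lim_transform_eventually[OF limP eventually_mono[OF eventually_ge_at_top[of 0] trunc]])
  \<comment> \<open>Boundary term at infinity: the primitive grows at most like \<open>w\<close>,
    and \<open>g\<close> decays like 1/M.\<close>
  have "((\<lambda>M. G M * g M) \<longlongrightarrow> 0) at_top"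
  proof (rule Lim_null_comparison)
    have "((\<lambda>M. C * B * (w M / M)) \<longlongrightarrow> C * B * 0) at_top"
      by (intro tendsto_intros w(3))
    then show "((\<lambda>M. C * B * (w M / M)) \<longlongrightarrow> 0) at_top" by simp
    have "norm (G M * g M) \<le> C * B * (w M / M)" if "M > 0" for M
    proof -
      have "norm (G M) * norm (g M) \<le> (C * w M) * (B / M)"
        using primitive[OF that] decay[OF that] that order_trans[OF norm_ge_zero primitive[OF that]]
        by (intro mult_mono) (auto simp: G_def field_simps)
      then show ?thesis by (simp add: norm_mult mult_ac)
    qed
    then show "\<forall>\<^sub>F M in at_top. norm (G M * g M) \<le> C * B * (w M / M)"
      by (auto intro: eventually_mono[OF eventually_gt_at_top[of 0]])
  qed
  from tendsto_diff[OF this lim]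
  have "((\<lambda>M. integral {0..M} (\<lambda>x. E x * g x)) \<longlongrightarrow> - (LINT x|lebesgue. P x)) at_top"
    unfolding diff_0
    by (rule Lim_transform_eventually)
      (auto intro: eventually_mono[OF eventually_ge_at_top[of 0]] simp: parts(2))
  moreover have "norm (- (LINT x|lebesgue. P x)) \<le> C * (LINT x|lebesgue. norm (w x *\<^sub>R dg x))"
  proof -
    have "norm (- (LINT x|lebesgue. P x)) \<le> (LINT x|lebesgue. norm (P x))" by simp
    also have "\<dots> \<le> (LINT x|lebesgue. C * norm (w x *\<^sub>R dg x))"
      by (intro integral_mono integrable_norm[OF P] integrable_mult_right integrable_norm[OF wdg] Pb)
    finally show ?thesis by simp
  qed
  ultimately show thesis by (rule that)
qed

section \<open>Growth of the weight and the dispersion relation in terms of the phase\<close>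

lemma dispersive_weight_pos: "\<mu> > 0 \<Longrightarrow> x > 0 \<Longrightarrow> dispersive_weight \<mu> x > 0"
  unfolding dispersive_weight_def by (intro add_pos_pos mult_pos_pos) auto

lemma continuous_on_dispersive_weight: "continuous_on {0<..} (dispersive_weight \<mu>)"
  unfolding dispersive_weight_def[abs_def] by (intro continuous_intros) auto

text \<open>Both exponents, -1/2 and 3/4, are below 1; this margin is what the decay of the
  transform exploits at infinity.\<close>

lemma dispersive_weight_sublinear: "((\<lambda>x. dispersive_weight \<mu> x / x) \<longlongrightarrow> 0) at_top"
proof -
  have "((\<lambda>x. 1 / sqrt \<mu> * x powr (-3/2) + \<mu> powr (1/8) * x powr (-1/4)) \<longlongrightarrow>
      1 / sqrt \<mu> * 0 + \<mu> powr (1/8) * 0) at_top"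
    by (intro tendsto_intros tendsto_neg_powr filterlim_ident) simp_all
  then have "((\<lambda>x. 1 / sqrt \<mu> * x powr (-3/2) + \<mu> powr (1/8) * x powr (-1/4)) \<longlongrightarrow> 0) at_top"
    by simp
  then show ?thesis
  proof (rule Lim_transform_eventually)
    have "1 / sqrt \<mu> * x powr (-3/2) + \<mu> powr (1/8) * x powr (-1/4) = dispersive_weight \<mu> x / x" if "x > 0" for x
    proof -
      have "x powr (-3/2) = x powr (-1/2) * x powr (-1)" "x powr (-1/4) = x powr (3/4) * x powr (-1)"
        unfolding powr_add[symmetric] by simp_all
      moreover have "x powr (-1/2) = 1 / sqrt x" "x powr (-1) = 1 / x"
        using that powr_minus_divide[of x "1/2"] powr_minus_divide[of x 1] by (simp_all add: powr_half_sqrt)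
      ultimately show ?thesis using that by (simp add: dispersive_weight_def add_divide_distrib)
    qed
    then show "\<forall>\<^sub>F x in at_top. 1 / sqrt \<mu> * x powr (-3/2) + \<mu> powr (1/8) * x powr (-1/4) = dispersive_weight \<mu> x / x"
      by (auto intro: eventually_mono[OF eventually_gt_at_top[of 0]])
  qed
qed

text \<open>Pulling the square of \<open>k * \<xi>\<close> out of the root produces an absolute
  value, hence the sign split.\<close>

lemma omega_eq_phase:
  assumes "k > 0"
  shows "\<xi> * omega (k * \<xi>) = (if 0 \<le> \<xi> then phase (k * \<xi>) / k else - (phase (k * \<xi>) / k))"
proof (cases "\<xi> = 0")
  case False
  have "sqrt (k * \<xi> * tanh (k * \<xi>)) = sqrt ((k * \<xi>)\<^sup>2 * (tanh (k * \<xi>) / (k * \<xi>)))"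
    using False assms by (simp add: power2_eq_square)
  also have "\<dots> = k * \<bar>\<xi>\<bar> * sqrt (tanh (k * \<xi>) / (k * \<xi>))"
    by (subst real_sqrt_mult) (use assms in \<open>simp add: abs_mult\<close>)
  finally show ?thesis using False assms by (simp add: phase_def omega_def)
qed (simp add: phase_def omega_def)

lemma phase_minus: "phase (- x) = phase x"
  by (simp add: phase_def)

text \<open>The decay bound alone does not make the transform integrable, so convergence of the
  truncated integrals belongs to the conclusion.\<close>

theorem proposition3p10:
  "\<exists>C>0. \<forall>(f :: real \<Rightarrow> complex) (df :: real \<Rightarrow> complex) (\<mu> :: real).
     f \<in> W11 \<longrightarrow> fourier f 0 = 0 \<longrightarrow> \<mu> > 0 \<longrightarrow>
     has_weak_derivative (fourier f) df \<longrightarrow>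
     integrable lebesgue (\<lambda>\<xi>. (1 / sqrt \<bar>\<xi>\<bar>) *\<^sub>R df \<xi>) \<longrightarrow>
     integrable lebesgue (\<lambda>\<xi>. (\<bar>\<xi>\<bar> powr (3/4)) *\<^sub>R df \<xi>) \<longrightarrow>
     (\<forall>t>0. \<forall>X::real. \<exists>I.
        ((\<lambda>M::real. LINT \<xi>:{-M..M}|lebesgue.
             exp (- (\<i> * of_real (t * \<xi> * omega (sqrt \<mu> * \<xi>)))) * exp (\<i> * of_real (X * \<xi>))
               * fourier f \<xi>) \<longlongrightarrow> I) at_top \<and>
        cmod I \<le> C / sqrt t *
          (1 / sqrt \<mu> * (LINT \<xi>|lebesgue. norm ((1 / sqrt \<bar>\<xi>\<bar>) *\<^sub>R df \<xi>))
           + \<mu> powr (1/8) * (LINT \<xi>|lebesgue. norm ((\<bar>\<xi>\<bar> powr (3/4)) *\<^sub>R df \<xi>))))"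
proof -
  obtain C where C: "C > 0" and primitive: "\<And>\<mu> t X x. \<mu> > 0 \<Longrightarrow> t > 0 \<Longrightarrow> x > 0 \<Longrightarrow>
      norm (integral {0..x} (\<lambda>x. cis (dispersive_phase \<mu> t X x))
        - integral {0..1 / sqrt \<mu>} (\<lambda>x. cis (dispersive_phase \<mu> t X x)))
      \<le> C / sqrt t * dispersive_weight \<mu> x"
    using dispersive_primitive_bound by blast
  show ?thesis
  \<comment> \<open>One \<open>C\<close> for each half line.\<close>
  proof (intro exI[of _ "2 * C"] conjI allI impI)
    show "2 * C > 0" using C by simp
    fix f df :: "real \<Rightarrow> complex" and \<mu> t X :: real
    assume f: "f \<in> W11" and f0: "fourier f 0 = 0" and \<mu>: "\<mu> > 0"
      and df: "has_weak_derivative (fourier f) df"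
      and u1: "integrable lebesgue (\<lambda>\<xi>. (1 / sqrt \<bar>\<xi>\<bar>) *\<^sub>R df \<xi>)"
      and u2: "integrable lebesgue (\<lambda>\<xi>. (\<bar>\<xi>\<bar> powr (3/4)) *\<^sub>R df \<xi>)"
      and t: "t > 0"
    define g where "g = fourier f"
    define w where "w = dispersive_weight \<mu>"
    define E where "E = (\<lambda>x. cis (dispersive_phase \<mu> t X x))"
    have gc: "continuous_on UNIV g"
      unfolding g_def using f by (intro continuous_on_fourier) (simp add: W11_def)
    have incr: "(df has_integral (g y - g x)) {x..y}" if "x \<le> y" for x y
      using weak_derivative_has_integral[OF df _ that] gc by (simp add: g_def)
    have dfi: "df absolutely_integrable_on {a..b}" for a b
      using df unfolding has_weak_derivative_def locally_integrable_def by simp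
    obtain B where B: "\<And>\<xi>. \<bar>\<xi>\<bar> * norm (g \<xi>) \<le> B"
      unfolding g_def using fourier_decay[OF f] by blast
    have weq: "w \<xi> *\<^sub>R df \<xi> = (1 / sqrt \<mu>) *\<^sub>R ((1 / sqrt \<bar>\<xi>\<bar>) *\<^sub>R df \<xi>) + (\<mu> powr (1/8)) *\<^sub>R ((\<bar>\<xi>\<bar> powr (3/4)) *\<^sub>R df \<xi>)" for \<xi>
      by (simp add: w_def dispersive_weight_def scaleR_left_distrib)
    have W: "integrable lebesgue (\<lambda>\<xi>. w \<xi> *\<^sub>R df \<xi>)"
      unfolding weq by (intro Bochner_Integration.integrable_add integrable_scaleR_right u1 u2)
    have w0: "w \<xi> \<ge> 0" for \<xi> unfolding w_def dispersive_weight_def using \<mu> by simp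
    \<comment> \<open>Both coefficients of the weight are nonnegative, so the norm splits with
      equality and the weighted norm is exactly the right-hand side.\<close>
    have N: "(LINT \<xi>|lebesgue. norm (w \<xi> *\<^sub>R df \<xi>)) =
        1 / sqrt \<mu> * (LINT \<xi>|lebesgue. norm ((1 / sqrt \<bar>\<xi>\<bar>) *\<^sub>R df \<xi>))
           + \<mu> powr (1/8) * (LINT \<xi>|lebesgue. norm ((\<bar>\<xi>\<bar> powr (3/4)) *\<^sub>R df \<xi>))"
    proof -
      have "norm (w \<xi> *\<^sub>R df \<xi>) = 1 / sqrt \<mu> * norm ((1 / sqrt \<bar>\<xi>\<bar>) *\<^sub>R df \<xi>)
          + \<mu> powr (1/8) * norm ((\<bar>\<xi>\<bar> powr (3/4)) *\<^sub>R df \<xi>)" for \<xi>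
        using w0[of \<xi>] by (simp add: w_def dispersive_weight_def distrib_right)
      then show ?thesis
        using integrable_norm[OF u1] integrable_norm[OF u2]
        by (simp only: Bochner_Integration.integral_add integrable_mult_right integral_mult_right_zero)
    qed
    have wev: "w (- \<xi>) = w \<xi>" for \<xi> by (simp add: w_def dispersive_weight_def)
    have Ec: "continuous_on UNIV E"
      unfolding E_def by (intro continuous_on_cis continuous_on_dispersive_phase)
    have prim: "norm (integral {0..x} E - integral {0..1 / sqrt \<mu>} E) \<le> C / sqrt t * w x" if "x > 0" for x
      unfolding E_def w_def by (rule primitive[OF \<mu> t that])
    note wp = continuous_on_dispersive_weight[of \<mu>, folded w_def] dispersive_weight_pos[OF \<mu>, folded w_def]
      dispersive_weight_sublinear[of \<mu>, folded w_def]
    obtain I1 where I1: "((\<lambda>M. integral {0..M} (\<lambda>x. E x * g x)) \<longlongrightarrow> I1) at_top"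
      "norm I1 \<le> C / sqrt t * (LINT x|lebesgue. norm (w x *\<^sub>R df x))"
    proof (rule half_line_oscillatory_integral[OF Ec prim wp, where g = g and dg = df and B = B])
      show "x * norm (g x) \<le> B" if "x > 0" for x using B[of x] that by simp
    qed (use incr dfi f0 W in \<open>simp_all add: g_def\<close>)
    \<comment> \<open>Reflection alone would change the sign of the phase; conjugating as well
      restores it, so the negative half line has the same \<open>E\<close>, with the same
      \<open>X\<close> and \<open>t\<close>. The minus sign in \<open>dh\<close> comes from the
      reflection.\<close>
    define h where "h x = cnj (g (- x))" for x
    define dh where "dh x = - cnj (df (- x))" for x
    have Wh: "integrable lebesgue (\<lambda>x. w x *\<^sub>R dh x)"
      using lebesgue_integrable_reflect(1)[OF W] unfolding wev dh_def
      by (simp add: complex_cnj_scaleR[symmetric] del: complex_cnj_scaleR)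
    have Nh: "(LINT x|lebesgue. norm (w x *\<^sub>R dh x)) = (LINT x|lebesgue. norm (w x *\<^sub>R df x))"
      using lebesgue_integrable_reflect(2)[OF integrable_norm[OF W]] unfolding wev dh_def by simp
    have hincr: "(dh has_integral (h y - h x)) {x..y}" if "x \<le> y" for x y
    proof -
      have "(df has_integral (g (- x) - g (- y))) {- y..- x}" using that by (intro incr) simp
      then have "((\<lambda>s. df (- s)) has_integral (g (- x) - g (- y))) {x..y}"
        using has_integral_reflect_real[where f = df and a = "- y" and b = "- x"] by simp
      from has_integral_neg[OF has_integral_cnj[THEN iffD2, OF this]]
      show ?thesis by (simp add: dh_def[abs_def] h_def o_def)
    qed
    have dhi: "dh absolutely_integrable_on {0..M}" for M
    proof -
      have "(\<lambda>x. df (- x)) absolutely_integrable_on {0..M}"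
        using absolutely_integrable_reflect_real[where f = df and a = "- M" and b = 0] dfi by simp
      from absolutely_integrable_linear[OF this bounded_linear_minus[OF bounded_linear_cnj]]
      show ?thesis by (simp add: dh_def[abs_def] o_def)
    qed
    obtain I2 where I2: "((\<lambda>M. integral {0..M} (\<lambda>x. E x * h x)) \<longlongrightarrow> I2) at_top"
      "norm I2 \<le> C / sqrt t * (LINT x|lebesgue. norm (w x *\<^sub>R dh x))"
    proof (rule half_line_oscillatory_integral[OF Ec prim wp, where g = h and dg = dh and B = B])
      show "x * norm (h x) \<le> B" if "x > 0" for x using B[of "- x"] that by (simp add: h_def)
    qed (use hincr dhi f0 Wh in \<open>simp_all add: g_def h_def\<close>)
    define F where "F \<xi> = exp (- (\<i> * complex_of_real (t * \<xi> * omega (sqrt \<mu> * \<xi>)))) * exp (\<i> * of_real (X * \<xi>))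
               * fourier f \<xi>" for \<xi>
    have k: "sqrt \<mu> > 0" using \<mu> by simp
    have Fcis: "F \<xi> = cis (X * \<xi> - t * (\<xi> * omega (sqrt \<mu> * \<xi>))) * g \<xi>" for \<xi>
      by (simp add: F_def g_def cis_conv_exp exp_add[symmetric] algebra_simps)
    have Fpos: "F \<xi> = E \<xi> * g \<xi>" if "0 \<le> \<xi>" for \<xi>
      unfolding Fcis omega_eq_phase[OF k] using that by (simp add: E_def dispersive_phase_def)
    have Fneg: "F (- \<xi>) = cnj (E \<xi> * h \<xi>)" if "0 \<le> \<xi>" for \<xi>
    proof -
      \<comment> \<open>Frequency 0 is separate: there \<open>- \<xi>\<close> falls into the
        nonnegative branch of \<open>omega_eq_phase\<close>, which agrees because
        \<open>phase 0 = 0\<close>.\<close>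
      have "F (- \<xi>) = cis (- dispersive_phase \<mu> t X \<xi>) * g (- \<xi>)"
        unfolding Fcis omega_eq_phase[OF k] dispersive_phase_def using that
        by (cases "\<xi> = 0") (simp_all add: phase_minus, simp add: phase_def)
      then show ?thesis by (simp add: E_def h_def cis_cnj)
    qed
    have hc: "continuous_on UNIV h"
      unfolding h_def[abs_def] by (intro continuous_intros continuous_on_compose2[OF gc]) auto
    have Fa: "F absolutely_integrable_on {-M..M}" if "0 \<le> M" for M
    proof -
      have "(\<lambda>x. E x * g x) absolutely_integrable_on {0..M}"
        by (intro absolutely_integrable_continuous_real continuous_intros
          continuous_on_subset[OF Ec] continuous_on_subset[OF gc]) auto
      then have "F absolutely_integrable_on {0..M}"
        by (rule set_integrable_cong[THEN iffD1, rotated -1]) (auto simp: Fpos)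
      moreover have "F absolutely_integrable_on {-M..0}"
      proof -
        have "(\<lambda>x. cnj (E x * h x)) absolutely_integrable_on {0..M}"
          by (intro absolutely_integrable_continuous_real continuous_intros
            continuous_on_subset[OF Ec] continuous_on_subset[OF hc]) auto
        then have "(\<lambda>x. F (- x)) absolutely_integrable_on {0..M}"
          by (rule set_integrable_cong[THEN iffD1, rotated -1]) (auto simp: Fneg)
        then show ?thesis using absolutely_integrable_reflect_real[where f = F and a = "- M" and b = 0] by simp
      qed
      ultimately have "F absolutely_integrable_on {-M..0} \<union> {0..M}"
        by (intro set_integrable_Un) auto
      moreover have "{-M..0} \<union> {0..M} = {-M..M}" using that by auto
      ultimately show ?thesis by simp
    qed
    have split: "(LINT \<xi>:{-M..M}|lebesgue. F \<xi>) = integral {0..M} (\<lambda>x. E x * g x) + cnj (integral {0..M} (\<lambda>x. E x * h x))"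
      if M: "0 \<le> M" for M
    proof -
      have "(LINT \<xi>:{-M..M}|lebesgue. F \<xi>) = integral {-M..M} F"
        by (rule set_lebesgue_integral_eq_integral(2)[OF Fa[OF M]])
      also have "\<dots> = integral {0..M} F + integral {-M..0} F"
        using Henstock_Kurzweil_Integration.integral_combine[OF _ M set_lebesgue_integral_eq_integral(1)[OF Fa[OF M]]] M
        by (simp add: add.commute)
      also have "integral {-M..0} F = integral {0..M} (\<lambda>x. F (- x))"
        using Henstock_Kurzweil_Integration.integral_reflect_real[where f = F and a = "- M" and b = 0] by simp
      also have "\<dots> = integral {0..M} (\<lambda>x. cnj (E x * h x))"
        by (rule Henstock_Kurzweil_Integration.integral_cong) (simp add: Fneg)
      also have "\<dots> = cnj (integral {0..M} (\<lambda>x. E x * h x))"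
        by (rule Henstock_Kurzweil_Integration.integral_cnj[symmetric])
      also have "integral {0..M} F = integral {0..M} (\<lambda>x. E x * g x)"
        by (rule Henstock_Kurzweil_Integration.integral_cong) (simp add: Fpos)
      finally show ?thesis .
    qed
    have "((\<lambda>M. LINT \<xi>:{-M..M}|lebesgue. F \<xi>) \<longlongrightarrow> I1 + cnj I2) at_top"
      by (rule Lim_transform_eventually[OF tendsto_add[OF I1(1) tendsto_cnj[OF I2(1)]]])
        (auto intro: eventually_mono[OF eventually_ge_at_top[of 0]] simp: split)
    moreover have "norm (I1 + cnj I2) \<le> 2 * C / sqrt t * (LINT \<xi>|lebesgue. norm (w \<xi> *\<^sub>R df \<xi>))"
      using norm_triangle_ineq[of I1 "cnj I2"] I1(2) I2(2) unfolding Nh by simp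
    ultimately show "\<exists>I. ((\<lambda>M::real. LINT \<xi>:{-M..M}|lebesgue.
             exp (- (\<i> * of_real (t * \<xi> * omega (sqrt \<mu> * \<xi>)))) * exp (\<i> * of_real (X * \<xi>))
               * fourier f \<xi>) \<longlongrightarrow> I) at_top \<and>
        cmod I \<le> 2 * C / sqrt t *
          (1 / sqrt \<mu> * (LINT \<xi>|lebesgue. norm ((1 / sqrt \<bar>\<xi>\<bar>) *\<^sub>R df \<xi>))
           + \<mu> powr (1/8) * (LINT \<xi>|lebesgue. norm ((\<bar>\<xi>\<bar> powr (3/4)) *\<^sub>R df \<xi>)))"
      unfolding N F_def by blast
  qed
qed

end
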